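(* Let $\lambda^{(m)}$ be an $m$-partition of size $n$. For an involution $\theta\in\{\gamma,\omega,\varpi\}$ of $\mathfrak{R}$, let $\langle,\rangle_{\theta}\colon U_{\lambda^{(m)}}\times U_{\lambda^{(m)}}\to\mathfrak{R}$ be the bi-additive map with $\langle fu,gv\rangle_{\theta}=f\,\theta(g)\,\langle u,v\rangle_{\theta}$ ($f,g\in\mathfrak{R}$, $u,v\in U_{\lambda^{(m)}}$) determined on basis vectors by $\langle\mathcal{X}_{\lambda^{(m)}},\mathcal{X}'_{\lambda^{(m)}}\rangle_\theta=0$ for different standard $m$-tableaux $X_{\lambda^{(m)}}\neq X'_{\lambda^{(m)}}$ of shape $\lambda^{(m)}$ and $$\langle\mathcal{X}_{\lambda^{(m)}},\mathcal{X}_{\lambda^{(m)}}\rangle_\theta=\prod_{j<k,\ c^{(j)}\neq c^{(k)},\ c^{(j)}\neq c^{(k)}q^{\pm2}}\frac{q^{-1}c^{(j)}-q\,c^{(k)}}{c^{(j)}-c^{(k)}},\qquad c^{(i)}:=c(X_{\lambda^{(m)}}|i).$$ Then, for all $u,v\in U_{\lambda^{(m)}}$ and all $\mathsf{a}\in\{\tau,\sigma_1,\dots,\sigma_{n-1}\}$: (1) $\langle \mathsf{a}(u),\mathsf{a}^{-1}(v)\rangle_{\gamma}=\langle u,v\rangle_{\gamma}$; (2) $\langle \mathsf{a}(u),\mathsf{a}(v)\rangle_{\omega}=\langle u,v\rangle_{\omega}$; (3) $\langle \mathsf{a}(u),\mathsf{a}(v)\rangle_{\varpi}=\langle u,v\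rangle_{\varpi}$.
   Context: Ring and involutions. Let $m,n\geq1$ and let $q,v_1,\dots,v_m$ be indeterminates. $\mathfrak{R}$ is the localization of $\mathbb{C}[q^{\pm1},v_1^{\pm1},\dots,v_m^{\pm1}]$ with respect to the multiplicative set generated by $\{1+q^2+\dots+q^{2N}\}_{N=1,\dots,n}\cup\{q^{2i}v_j-v_k\}_{j\neq k,\,-n<i<n}$. $\gamma$ is the involution of $\mathfrak{R}$ extending complex conjugation of the coefficients of Laurent polynomials (fixing $q,v_1,\dots,v_m$). $\omega$ is the $\mathbb{C}$-linear ring involution of $\mathfrak{R}$ with $q\mapsto q^{-1}$, $v_j\mapsto v_j^{-1}$. $\varpi:=\omega\circ\gamma$. Algebra. $H(m,1,n)$ is here the associative unital $\mathfrak{R}$-algebra generated by $\tau,\sigma_1,\dots,\sigma_{n-1}$ with relations $\sigma_i\sigma_{i+1}\sigma_i=\sigma_{i+1}\sigma_i\sigma_{i+1}$; $\sigma_i\sigma_j=\sigma_j\sigma_i$ if $|i-j|>1$; $\tau\sigma_1\tau\sigma_1=\sigma_1\tau\sigma_1\tau$; $\tau\sigma_i=\sigma_i\tau$ for $i>1$; $\sigma_i^2=(q-q^{-1})\sigma_i+1$; $(\tau-v_1)\cdots(\tau-v_m)=0$. The generators are invertible. Tableaux. An $m$-partition of $n$ is an $m$-tuple $\lambda^{(m)}=(\lambda_1,\dots,\lambda_m)$ of partitions with $|\lambda_1|+\dots+|\lambda_m|=n$. The content of the node in row $r$ and column $s$ of the $k$-th diagram is $v_kq^{2(s-r)}$.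 A standard $m$-tableau of shape $\lambda^{(m)}$ is a bijective filling of all nodes with $1,\dots,n$ such that in every diagram the numbers increase along rows (to the right) and columns (downwards). $c(X_{\lambda^{(m)}}|i)$ is the content of the node carrying $i$ in $X_{\lambda^{(m)}}$; $X_{\lambda^{(m)}}^{s_i}$ is obtained by exchanging $i$ and $i+1$. Module. $U_{\lambda^{(m)}}$ is the free $\mathfrak{R}$-module with basis $\{\mathcal{X}_{\lambda^{(m)}}\}$ indexed by the standard $m$-tableaux of shape $\lambda^{(m)}$, with the $H(m,1,n)$-action (with $c^{(i)}:=c(X_{\lambda^{(m)}}|i)$) $$\tau(\mathcal{X}_{\lambda^{(m)}})=c^{(1)}\mathcal{X}_{\lambda^{(m)}},\qquad \sigma_i(\mathcal{X}_{\lambda^{(m)}})=\frac{(q-q^{-1})c^{(i+1)}}{c^{(i+1)}-c^{(i)}}\mathcal{X}_{\lambda^{(m)}}+\frac{qc^{(i+1)}-q^{-1}c^{(i)}}{c^{(i+1)}-c^{(i)}}\mathcal{X}_{\lambda^{(m)}}^{s_i},$$ where $\mathcal{X}_{\lambda^{(m)}}^{s_i}$ is the basis vector of $X_{\lambda^{(m)}}^{s_i}$ if it is standard and $0$ otherwise. *)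

theory Defs
  imports
    "HOL-Library.Poly_Mapping"
    "HOL-Library.FuncSet"
    "HOL-Computational_Algebra.Polynomial_Factorial"
    "HOL-Combinatorics.Transposition"
    "HOL-Algebra.QuotRing"
begin

section \<open>The ground ring and its involutions\<close>

text \<open>
  Complex Laurent polynomials in countably many indeterminates, as finitely supported functions
  on integer exponent vectors.  Indeterminate \<open>0\<close> is \<open>q\<close> and indeterminate \<open>Suc k\<close> is the parameter
  attached to the \<open>k\<close>-th diagram.  Diagrams, rows and columns are numbered from \<open>0\<close>, so that
  \<open>v\<^sub>1,\<dots>,v\<^sub>m\<close> are \<open>vvar 0,\<dots>,vvar (m - 1)\<close>.
\<close>

type_synonym laurent = "(nat \<Rightarrow>\<^sub>0 int) \<Rightarrow>\<^sub>0 complex"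
type_synonym ratfun = "laurent fract"

definition indet :: "nat \<Rightarrow> laurent" where
  "indet i = Poly_Mapping.single (Poly_Mapping.single i 1) 1"

definition qvar :: ratfun where
  "qvar = to_fract (indet 0)"

definition vvar :: "nat \<Rightarrow> ratfun" where
  "vvar k = to_fract (indet (Suc k))"

definition cconst :: "complex \<Rightarrow> ratfun" where
  "cconst a = to_fract (Poly_Mapping.single 0 a)"

definition laurent_ring :: "nat \<Rightarrow> laurent set" where
  "laurent_ring m = {p. \<forall>e\<in>Poly_Mapping.keys p. Poly_Mapping.keys e \<subseteq> {0..m}}"

inductive_set denoms :: "nat \<Rightarrow> nat \<Rightarrow> ratfun set" for m n :: nat where
  one: "1 \<in> denoms m n"
| qsum: "1 \<le> N \<Longrightarrow> N \<le> n \<Longrightarrow> (\<Sum>i\<le>N. qvar ^ (2 * i)) \<in> denoms m n"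
| vdiff: "j < m \<Longrightarrow> k < m \<Longrightarrow> j \<noteq> k \<Longrightarrow> - int n < i \<Longrightarrow> i < int n
    \<Longrightarrow> qvar powi (2 * i) * vvar j - vvar k \<in> denoms m n"
| mult: "a \<in> denoms m n \<Longrightarrow> b \<in> denoms m n \<Longrightarrow> a * b \<in> denoms m n"

text \<open>
  The Laurent polynomials form a domain, so the localization is the subring of the fraction field
  consisting of the fractions with denominators in the multiplicative set.
\<close>

definition ground_ring :: "nat \<Rightarrow> nat \<Rightarrow> ratfun set" where
  "ground_ring m n = {to_fract p / s | p s. p \<in> laurent_ring m \<and> s \<in> denoms m n}"

definition conj_laurent :: "laurent \<Rightarrow> laurent" where
  "conj_laurent p = Poly_Mapping.map cnj p"

definition inv_laurent :: "laurent \<Rightarrow> laurent" where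
  "inv_laurent p = Poly_Mapping.map_key uminus p"

lemma inj_uminus_exp: "inj (uminus :: (nat \<Rightarrow>\<^sub>0 int) \<Rightarrow> _)"
  by (simp add: inj_on_def)

lemma lookup_conj_laurent: "Poly_Mapping.lookup (conj_laurent p) e = cnj (Poly_Mapping.lookup p e)"
  by (simp add: conj_laurent_def Poly_Mapping.map.rep_eq when_def)

lemma lookup_inv_laurent: "Poly_Mapping.lookup (inv_laurent p) e = Poly_Mapping.lookup p (- e)"
  by (simp add: inv_laurent_def map_key.rep_eq inj_uminus_exp)

lemma single_plus_induct:
  fixes p :: "'a \<Rightarrow>\<^sub>0 'b::monoid_add"
  assumes "P 0" and "\<And>p e a. P p \<Longrightarrow> P (Poly_Mapping.single e a + p)"
  shows "P p"
proof (induction p rule: update_induct)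
  case const
  show ?case by (rule assms)
next
  case (update f e a)
  have "Poly_Mapping.update e a f = Poly_Mapping.single e a + f"
    using update(1)
    by (intro poly_mapping_eqI) (auto simp: lookup_update lookup_add lookup_single in_keys_iff)
  then show ?case using assms(2)[OF update(3)] by simp
qed

lemma mult_hom_from_singles:
  fixes h :: "laurent \<Rightarrow> laurent"
  assumes add: "\<And>p p'. h (p + p') = h p + h p'"
    and sing: "\<And>e a e' a'. h (Poly_Mapping.single (e + e') (a * a'))
      = h (Poly_Mapping.single e a) * h (Poly_Mapping.single e' a')"
  shows "h (p * p') = h p * h p'"
proof -
  have zero: "h 0 = 0" using add[of 0 0] by simp
  have *: "h (Poly_Mapping.single e a * p') = h (Poly_Mapping.single e a) * h p'" for e a
    by (induction p' rule: single_plus_induct)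
      (simp_all add: zero add sing mult_single distrib_left)
  show ?thesis
    by (induction p rule: single_plus_induct) (simp_all add: zero add * distrib_right)
qed

lemma conj_laurent_single [simp]:
  "conj_laurent (Poly_Mapping.single e a) = Poly_Mapping.single e (cnj a)"
  by (intro poly_mapping_eqI) (simp add: lookup_conj_laurent lookup_single when_def)

lemma inv_laurent_single [simp]:
  "inv_laurent (Poly_Mapping.single e a) = Poly_Mapping.single (- e) a"
  by (intro poly_mapping_eqI) (auto simp: lookup_inv_laurent lookup_single when_def)

lemma conj_laurent_add: "conj_laurent (p + p') = conj_laurent p + conj_laurent p'"
  by (intro poly_mapping_eqI) (simp add: lookup_conj_laurent lookup_add)

lemma inv_laurent_add: "inv_laurent (p + p') = inv_laurent p + inv_laurent p'"
  by (intro poly_mapping_eqI) (simp add: lookup_inv_laurent lookup_add)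

lemma conj_laurent_mult: "conj_laurent (p * p') = conj_laurent p * conj_laurent p'"
  by (rule mult_hom_from_singles) (simp_all add: conj_laurent_add mult_single)

lemma inv_laurent_mult: "inv_laurent (p * p') = inv_laurent p * inv_laurent p'"
  by (rule mult_hom_from_singles) (simp_all add: inv_laurent_add mult_single)

lemma conj_laurent_conj [simp]: "conj_laurent (conj_laurent p) = p"
  by (intro poly_mapping_eqI) (simp add: lookup_conj_laurent)

lemma inv_laurent_inv [simp]: "inv_laurent (inv_laurent p) = p"
  by (intro poly_mapping_eqI) (simp add: lookup_inv_laurent)

lemma conj_laurent_0 [simp]: "conj_laurent 0 = 0"
  by (intro poly_mapping_eqI) (simp add: lookup_conj_laurent)

lemma inv_laurent_0 [simp]: "inv_laurent 0 = 0"
  by (intro poly_mapping_eqI) (simp add: lookup_inv_laurent)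

lemma conj_laurent_eq_0_iff [simp]: "conj_laurent p = 0 \<longleftrightarrow> p = 0"
  by (metis conj_laurent_0 conj_laurent_conj)

lemma inv_laurent_eq_0_iff [simp]: "inv_laurent p = 0 \<longleftrightarrow> p = 0"
  by (metis inv_laurent_0 inv_laurent_inv)

lemma conj_laurent_1 [simp]: "conj_laurent 1 = 1"
  by (metis conj_laurent_single complex_cnj_one single_one)

lemma inv_laurent_1 [simp]: "inv_laurent 1 = 1"
  by (metis inv_laurent_single minus_zero single_one)

text \<open>Extension of an injective multiplicative map to fractions.\<close>

definition fract_map :: "(laurent \<Rightarrow> laurent) \<Rightarrow> ratfun \<Rightarrow> ratfun" where
  "fract_map h x = (THE y. \<exists>a b. b \<noteq> 0 \<and> x = Fract a b \<and> y = Fract (h a) (h b))"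

lemma fract_map_Fract:
  assumes mult: "\<And>a b. h (a * b) = h a * h b" and nz: "\<And>a. h a = 0 \<longleftrightarrow> a = 0"
  shows "fract_map h (Fract a b) = Fract (h a) (h b)"
proof (cases "b = 0")
  case False
  have "y = Fract (h a) (h b)"
    if "d \<noteq> 0" "Fract a b = Fract c d" "y = Fract (h c) (h d)" for y c d
  proof -
    have "h (a * d) = h (c * b)" using that False by (simp add: eq_fract)
    then show ?thesis using that False nz by (simp add: eq_fract mult)
  qed
  then show ?thesis unfolding fract_map_def using False by (intro the_equality) blast+
next
  case True
  have h0: "h 0 = 0" by (simp add: nz)
  have "y = Fract (h a) (h b)"
    if "d \<noteq> 0" "Fract a b = Fract c d" "y = Fract (h c) (h d)" for y c d
  proof -
    have "Fract c d = Fract 0 1" using that True by (simp add: eq_fract)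
    then have "c = 0" using that by (simp add: eq_fract)
    then show ?thesis using that True nz by (simp add: eq_fract h0)
  qed
  moreover have "\<exists>c d. d \<noteq> 0 \<and> Fract a b = Fract c d \<and> Fract (h a) (h b) = Fract (h c) (h d)"
    using True nz[of 1] by (intro exI[of _ 0] exI[of _ 1]) (simp add: eq_fract h0)
  ultimately show ?thesis unfolding fract_map_def by (intro the_equality) blast+
qed

text \<open>The involutions \<open>\<gamma>\<close>, \<open>\<omega>\<close> and \<open>\<varpi>\<close>, on the whole fraction field.\<close>

definition gamma_invol :: "ratfun \<Rightarrow> ratfun" where
  "gamma_invol = fract_map conj_laurent"

definition omega_invol :: "ratfun \<Rightarrow> ratfun" where
  "omega_invol = fract_map inv_laurent"

definition varpi_invol :: "ratfun \<Rightarrow> ratfun" where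
  "varpi_invol = omega_invol \<circ> gamma_invol"

lemma gamma_Fract: "gamma_invol (Fract a b) = Fract (conj_laurent a) (conj_laurent b)"
  by (simp add: gamma_invol_def fract_map_Fract conj_laurent_mult)

lemma omega_Fract: "omega_invol (Fract a b) = Fract (inv_laurent a) (inv_laurent b)"
  by (simp add: omega_invol_def fract_map_Fract inv_laurent_mult)

lemma gamma_add: "gamma_invol (x + y) = gamma_invol x + gamma_invol y"
  by (cases x; cases y) (simp add: gamma_Fract conj_laurent_add conj_laurent_mult)

lemma gamma_mult: "gamma_invol (x * y) = gamma_invol x * gamma_invol y"
  by (cases x; cases y) (simp add: gamma_Fract conj_laurent_mult)

lemma gamma_1 [simp]: "gamma_invol 1 = 1"
  by (simp add: One_fract_def gamma_Fract)

lemma gamma_0 [simp]: "gamma_invol 0 = 0"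
  by (simp add: Zero_fract_def gamma_Fract)

lemma omega_add: "omega_invol (x + y) = omega_invol x + omega_invol y"
  by (cases x; cases y) (simp add: omega_Fract inv_laurent_add inv_laurent_mult)

lemma omega_mult: "omega_invol (x * y) = omega_invol x * omega_invol y"
  by (cases x; cases y) (simp add: omega_Fract inv_laurent_mult)

lemma omega_1 [simp]: "omega_invol 1 = 1"
  by (simp add: One_fract_def omega_Fract)

lemma omega_0 [simp]: "omega_invol 0 = 0"
  by (simp add: Zero_fract_def omega_Fract)

lemma gamma_involutive [simp]: "gamma_invol (gamma_invol x) = x"
  by (cases x) (simp add: gamma_Fract)

lemma omega_involutive [simp]: "omega_invol (omega_invol x) = x"
  by (cases x) (simp add: omega_Fract)

lemma gamma_values:
  "gamma_invol (cconst a) = cconst (cnj a)"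
  "gamma_invol qvar = qvar"
  "gamma_invol (vvar k) = vvar k"
  by (simp_all add: cconst_def qvar_def vvar_def indet_def to_fract_def gamma_Fract)

lemma indet_inverse:
  "inverse (to_fract (indet i)) = to_fract (Poly_Mapping.single (- Poly_Mapping.single i 1) 1)"
proof -
  have "to_fract (indet i) * to_fract (Poly_Mapping.single (- Poly_Mapping.single i 1) 1) = 1"
    by (simp add: indet_def mult_single flip: to_fract_mult)
  then show ?thesis by (rule inverse_unique)
qed

lemma omega_values:
  "omega_invol (cconst a) = cconst a"
  "omega_invol qvar = inverse qvar"
  "omega_invol (vvar k) = inverse (vvar k)"
  by (simp_all add: cconst_def qvar_def vvar_def indet_inverse)
    (simp_all add: indet_def to_fract_def omega_Fract)


lemma laurent_ring_conj: "p \<in> laurent_ring m \<Longrightarrow> conj_laurent p \<in> laurent_ring m"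
  by (auto simp: laurent_ring_def in_keys_iff lookup_conj_laurent)

lemma laurent_ring_inv: "p \<in> laurent_ring m \<Longrightarrow> inv_laurent p \<in> laurent_ring m"
proof -
  assume p: "p \<in> laurent_ring m"
  have "Poly_Mapping.keys e \<subseteq> {0..m}" if "e \<in> Poly_Mapping.keys (inv_laurent p)" for e
  proof -
    have "- e \<in> Poly_Mapping.keys p" using that by (simp add: in_keys_iff lookup_inv_laurent)
    then have "Poly_Mapping.keys (- e) \<subseteq> {0..m}" using p unfolding laurent_ring_def by blast
    moreover have "Poly_Mapping.keys (- e) = Poly_Mapping.keys e" by (auto simp: in_keys_iff)
    ultimately show ?thesis by simp
  qed
  then show ?thesis by (simp add: laurent_ring_def)
qed

lemma gamma_sum: "gamma_invol (sum f A) = (\<Sum>i\<in>A. gamma_invol (f i))"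
  by (induction A rule: infinite_finite_induct) (simp_all add: gamma_add)

lemma gamma_power: "gamma_invol (x ^ i) = gamma_invol x ^ i"
  by (induction i) (simp_all add: gamma_mult)

lemma gamma_inverse: "gamma_invol (inverse x) = inverse (gamma_invol x)"
proof (cases "x = 0")
  case False
  have "gamma_invol x * gamma_invol (inverse x) = 1"
    using False by (simp flip: gamma_mult)
  then show ?thesis by (metis inverse_unique)
qed simp

lemma gamma_powi: "gamma_invol (x powi i) = gamma_invol x powi i"
  by (simp add: power_int_def gamma_power gamma_inverse)

lemma gamma_diff: "gamma_invol (x - y) = gamma_invol x - gamma_invol y"
  by (metis add_diff_cancel diff_add_cancel gamma_add)

lemma denoms_gamma: "s \<in> denoms m n \<Longrightarrow> gamma_invol s = s"
  by (induction rule: denoms.induct)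
    (simp_all add: gamma_sum gamma_power gamma_powi gamma_diff gamma_mult gamma_values)

lemma ground_ring_gamma:
  assumes "x \<in> ground_ring m n" shows "gamma_invol x \<in> ground_ring m n"
proof -
  obtain p s where x: "x = to_fract p / s" "p \<in> laurent_ring m" "s \<in> denoms m n"
    using assms by (auto simp: ground_ring_def)
  have "gamma_invol x = to_fract (conj_laurent p) / s"
    using x denoms_gamma[of s]
    by (simp add: divide_inverse gamma_mult gamma_inverse) (simp add: to_fract_def gamma_Fract)
  then show ?thesis using x laurent_ring_conj by (auto simp: ground_ring_def)
qed

lemma omega_sum: "omega_invol (sum f A) = (\<Sum>i\<in>A. omega_invol (f i))"
  by (induction A rule: infinite_finite_induct) (simp_all add: omega_add)

lemma omega_power: "omega_invol (x ^ i) = omega_invol x ^ i"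
  by (induction i) (simp_all add: omega_mult)

lemma omega_inverse: "omega_invol (inverse x) = inverse (omega_invol x)"
proof (cases "x = 0")
  case False
  have "omega_invol x * omega_invol (inverse x) = 1"
    using False by (simp flip: omega_mult)
  then show ?thesis by (metis inverse_unique)
qed simp

lemma omega_powi: "omega_invol (x powi i) = omega_invol x powi i"
  by (simp add: power_int_def omega_power omega_inverse)

lemma omega_diff: "omega_invol (x - y) = omega_invol x - omega_invol y"
  by (metis add_diff_cancel diff_add_cancel omega_add)

definition lmon :: "(nat \<Rightarrow>\<^sub>0 int) \<Rightarrow> ratfun" where
  "lmon e = to_fract (Poly_Mapping.single e 1)"

lemma lmon_add: "lmon (e + e') = lmon e * lmon e'"
  by (simp add: lmon_def mult_single flip: to_fract_mult)

lemma lmon_0: "lmon 0 = 1"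
  by (simp add: lmon_def)

lemma lmon_uminus: "lmon (- e) = inverse (lmon e)"
proof -
  have "lmon e * lmon (- e) = 1" by (simp add: lmon_0 flip: lmon_add)
  then show ?thesis by (metis inverse_unique)
qed

lemma lmon_nonzero: "lmon e \<noteq> 0"
  by (metis lmon_0 lmon_add add.right_inverse mult_zero_left zero_neq_one)

lemma qvar_lmon: "qvar = lmon (Poly_Mapping.single 0 1)"
  by (simp add: lmon_def qvar_def indet_def)

lemma vvar_lmon: "vvar k = lmon (Poly_Mapping.single (Suc k) 1)"
  by (simp add: lmon_def vvar_def indet_def)

lemma qvar_nonzero [simp]: "qvar \<noteq> 0"
  by (simp only: qvar_lmon lmon_nonzero not_False_eq_True)

lemma vvar_nonzero [simp]: "vvar k \<noteq> 0"
  by (simp only: vvar_lmon lmon_nonzero not_False_eq_True)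

definition exps :: "nat \<Rightarrow> (nat \<Rightarrow>\<^sub>0 int) set" where
  "exps m = {e. Poly_Mapping.keys e \<subseteq> {0..m}}"

lemma exps_add: "e \<in> exps m \<Longrightarrow> e' \<in> exps m \<Longrightarrow> e + e' \<in> exps m"
  using keys_add[of e e'] by (auto simp: exps_def)

lemma exps_uminus: "e \<in> exps m \<Longrightarrow> - e \<in> exps m"
  by (auto simp: exps_def in_keys_iff)

lemma lmon_exps_mult: "e \<in> exps m \<Longrightarrow> e' \<in> exps m \<Longrightarrow> \<exists>d\<in>exps m. lmon e * lmon e' = lmon d"
  using exps_add lmon_add by metis

lemma qvar_power_lmon: "\<exists>e\<in>exps m. inverse qvar ^ i = lmon e"
proof (induction i)
  case 0
  show ?case by (rule bexI[of _ 0]) (auto simp: lmon_0 exps_def)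
next
  case (Suc i)
  have "- Poly_Mapping.single 0 1 \<in> exps m"
    by (intro exps_uminus) (simp add: exps_def)
  then show ?case
    using Suc lmon_exps_mult unfolding power_Suc qvar_lmon lmon_uminus[symmetric] by metis
qed

lemma denoms_omega:
  assumes "s \<in> denoms m n"
  shows "\<exists>t\<in>denoms m n. \<exists>e\<in>exps m. omega_invol s = t * lmon e"
  using assms
proof (induction rule: denoms.induct)
  case one
  show ?case by (intro bexI[of _ 1] bexI[of _ 0]) (auto simp: lmon_0 exps_def denoms.one)
next
  case (qsum N)
  obtain e where e: "e \<in> exps m" "inverse qvar ^ (2 * N) = lmon e"
    using qvar_power_lmon by metis
  have "omega_invol (\<Sum>i\<le>N. qvar ^ (2 * i)) = (\<Sum>i\<le>N. inverse qvar ^ (2 * i))"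
    by (simp add: omega_sum omega_power omega_values)
  also have "\<dots> = (\<Sum>i\<le>N. inverse qvar ^ (2 * (N - i)))"
    by (rule sum.reindex_bij_witness[of _ "\<lambda>i. N - i" "\<lambda>i. N - i"]) auto
  also have "\<dots> = (\<Sum>i\<le>N. qvar ^ (2 * i)) * inverse qvar ^ (2 * N)"
    unfolding sum_distrib_right
  proof (rule sum.cong)
    fix i assume "i \<in> {..N}"
    then have "2 * N = 2 * i + 2 * (N - i)" by simp
    then have "inverse qvar ^ (2 * N) = inverse qvar ^ (2 * i) * inverse qvar ^ (2 * (N - i))"
      by (metis power_add)
    then show "inverse qvar ^ (2 * (N - i)) = qvar ^ (2 * i) * inverse qvar ^ (2 * N)"
      by (simp add: power_inverse)
  qed simp
  finally show ?case using e denoms.qsum[OF qsum] by metis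
next
  case (vdiff j k i)
  define d where "d = - Poly_Mapping.single (Suc j) 1 + - Poly_Mapping.single (Suc k) (1::int)"
  have d: "d \<in> exps m"
    unfolding d_def using vdiff by (intro exps_add exps_uminus) (auto simp: exps_def)
  have "omega_invol (qvar powi (2 * i) * vvar j - vvar k)
      = (qvar powi (2 * (- i)) * vvar k - vvar j) * (inverse (vvar j) * inverse (vvar k))"
    by (simp add: omega_diff omega_mult omega_powi omega_values power_int_minus
        power_int_inverse field_simps)
  also have "inverse (vvar j) * inverse (vvar k) = lmon d"
    by (simp only: d_def vvar_lmon lmon_add lmon_uminus)
  finally show ?case
    using d denoms.vdiff[of k m j n "- i"] vdiff by (metis neg_less_iff_less minus_minus)
next
  case (mult a b)
  then obtain s t d e where *: "s \<in> denoms m n" "t \<in> denoms m n" "d \<in> exps m" "e \<in> exps m"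
    "omega_invol a = s * lmon d" "omega_invol b = t * lmon e" by metis
  have "omega_invol (a * b) = (s * t) * lmon (d + e)"
    by (simp add: omega_mult lmon_add *)
  then show ?case using * exps_add denoms.mult by metis
qed

lemma laurent_ring_mult_single:
  assumes "p \<in> laurent_ring m" "e \<in> exps m"
  shows "p * Poly_Mapping.single e a \<in> laurent_ring m"
proof -
  have "d \<in> exps m" if d: "d \<in> Poly_Mapping.keys (p * Poly_Mapping.single e a)" for d
  proof -
    obtain d' where "d' \<in> Poly_Mapping.keys p" "d = d' + e"
      using keys_mult[of p "Poly_Mapping.single e a"] d by (auto split: if_splits)
    then show ?thesis using assms exps_add by (auto simp: laurent_ring_def exps_def)
  qed
  then show ?thesis by (simp add: laurent_ring_def exps_def)
qed

lemma ground_ring_omega: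
  assumes "x \<in> ground_ring m n" shows "omega_invol x \<in> ground_ring m n"
proof -
  obtain p s where x: "x = to_fract p / s" "p \<in> laurent_ring m" "s \<in> denoms m n"
    using assms by (auto simp: ground_ring_def)
  obtain t e where t: "t \<in> denoms m n" "e \<in> exps m" "omega_invol s = t * lmon e"
    using denoms_omega x by metis
  have "omega_invol x = to_fract (inv_laurent p) * lmon (- e) / t"
    using x t by (simp add: divide_inverse omega_mult omega_inverse lmon_uminus mult_ac)
      (simp add: to_fract_def omega_Fract)
  then have "omega_invol x = to_fract (inv_laurent p * Poly_Mapping.single (- e) 1) / t"
    by (simp add: lmon_def)
  moreover have "inv_laurent p * Poly_Mapping.single (- e) 1 \<in> laurent_ring m"
    by (intro laurent_ring_mult_single laurent_ring_inv exps_uminus x t)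
  ultimately show ?thesis
    using t unfolding ground_ring_def by blast
qed

lemma ground_ring_varpi: "x \<in> ground_ring m n \<Longrightarrow> varpi_invol x \<in> ground_ring m n"
  by (simp add: varpi_invol_def ground_ring_gamma ground_ring_omega)


section \<open>The algebra \<open>H(m,1,n)\<close>\<close>

datatype gen = Tau | Sigma nat

definition gens :: "nat \<Rightarrow> gen set" where
  "gens n = insert Tau (Sigma ` {1..<n})"

text \<open>
  Words in the generators, with concatenation written additively: finitely supported functions on
  words, with the convolution product of \<open>Poly_Mapping\<close>, then form the free associative algebra.
\<close>

datatype word = Word (letters: "gen list")

instantiation word :: monoid_add
begin

definition "0 = Word []"
definition "w + w' = Word (letters w @ letters w')"

instance
  by standard (simp_all add: zero_word_def plus_word_def)

end

definition gword :: "gen list \<Rightarrow> word \<Rightarrow>\<^sub>0 ratfun" where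
  "gword w = Poly_Mapping.single (Word w) 1"

definition scal :: "ratfun \<Rightarrow> word \<Rightarrow>\<^sub>0 ratfun" where
  "scal r = Poly_Mapping.single 0 r"

definition free_algebra :: "nat \<Rightarrow> nat \<Rightarrow> (word \<Rightarrow>\<^sub>0 ratfun) ring" where
  "free_algebra m n =
    \<lparr>carrier = {p. \<forall>w\<in>Poly_Mapping.keys p.
        Poly_Mapping.lookup p w \<in> ground_ring m n \<and> set (letters w) \<subseteq> gens n},
     monoid.mult = (*), one = 1, zero = 0, add = (+)\<rparr>"

definition hecke_relators :: "nat \<Rightarrow> nat \<Rightarrow> (word \<Rightarrow>\<^sub>0 ratfun) set" where
  "hecke_relators m n =
    {gword [Sigma i, Sigma (i + 1), Sigma i] - gword [Sigma (i + 1), Sigma i, Sigma (i + 1)] | i.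
        1 \<le> i \<and> i + 1 < n} \<union>
    {gword [Sigma i, Sigma j] - gword [Sigma j, Sigma i] | i j.
        1 \<le> i \<and> i < n \<and> 1 \<le> j \<and> j < n \<and> \<bar>int i - int j\<bar> > 1} \<union>
    (if 1 < n then {gword [Tau, Sigma 1, Tau, Sigma 1] - gword [Sigma 1, Tau, Sigma 1, Tau]} else {}) \<union>
    {gword [Tau, Sigma i] - gword [Sigma i, Tau] | i. 1 < i \<and> i < n} \<union>
    {gword [Sigma i, Sigma i] - scal (qvar - inverse qvar) * gword [Sigma i] - 1 | i.
        1 \<le> i \<and> i < n} \<union>
    {prod_list (map (\<lambda>k. gword [Tau] - scal (vvar k)) [0..<m])}"

definition hecke_ideal :: "nat \<Rightarrow> nat \<Rightarrow> (word \<Rightarrow>\<^sub>0 ratfun) set" where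
  "hecke_ideal m n = Idl\<^bsub>free_algebra m n\<^esub> (hecke_relators m n)"

definition hecke :: "nat \<Rightarrow> nat \<Rightarrow> (word \<Rightarrow>\<^sub>0 ratfun) set ring" where
  "hecke m n = free_algebra m n Quot hecke_ideal m n"

definition hgen :: "nat \<Rightarrow> nat \<Rightarrow> gen \<Rightarrow> (word \<Rightarrow>\<^sub>0 ratfun) set" where
  "hgen m n a = hecke_ideal m n +>\<^bsub>free_algebra m n\<^esub> gword [a]"

text \<open>The structure map of the \<open>ground_ring\<close>-algebra.\<close>

definition hscal :: "nat \<Rightarrow> nat \<Rightarrow> ratfun \<Rightarrow> (word \<Rightarrow>\<^sub>0 ratfun) set" where
  "hscal m n r = hecke_ideal m n +>\<^bsub>free_algebra m n\<^esub> scal r"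


section \<open>Multipartitions and standard tableaux\<close>

definition is_partition :: "nat list \<Rightarrow> bool" where
  "is_partition p \<longleftrightarrow> sorted_wrt (\<ge>) p \<and> 0 \<notin> set p"

definition is_multipartition :: "nat \<Rightarrow> nat \<Rightarrow> nat list list \<Rightarrow> bool" where
  "is_multipartition m n lam \<longleftrightarrow>
    length lam = m \<and> (\<forall>p\<in>set lam. is_partition p) \<and> sum_list (map sum_list lam) = n"

text \<open>A node is a triple of diagram, row and column.\<close>

type_synonym node = "nat \<times> nat \<times> nat"
type_synonym tableau = "node \<Rightarrow> nat"

definition nodes :: "nat list list \<Rightarrow> node set" where
  "nodes lam = {(k, r, s). k < length lam \<and> r < length (lam ! k) \<and> s < lam ! k ! r}"

definition node_content :: "node \<Rightarrow> ratfun" where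
  "node_content = (\<lambda>(k, r, s). vvar k * qvar powi (2 * (int s - int r)))"

definition standard_tableaux :: "nat \<Rightarrow> nat list list \<Rightarrow> tableau set" where
  "standard_tableaux n lam = {X \<in> extensional (nodes lam).
     bij_betw X (nodes lam) {1..n} \<and>
     (\<forall>k r s s'. (k, r, s) \<in> nodes lam \<and> (k, r, s') \<in> nodes lam \<and> s < s'
        \<longrightarrow> X (k, r, s) < X (k, r, s')) \<and>
     (\<forall>k r r' s. (k, r, s) \<in> nodes lam \<and> (k, r', s) \<in> nodes lam \<and> r < r'
        \<longrightarrow> X (k, r, s) < X (k, r', s))}"

definition tab_content :: "nat list list \<Rightarrow> tableau \<Rightarrow> nat \<Rightarrow> ratfun" where
  "tab_content lam X i = node_content (the_inv_into (nodes lam) X i)"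

definition swap_entries :: "nat list list \<Rightarrow> nat \<Rightarrow> tableau \<Rightarrow> tableau" where
  "swap_entries lam i X = restrict (Transposition.transpose i (i + 1) \<circ> X) (nodes lam)"


section \<open>The module\<close>

type_synonym vect = "tableau \<Rightarrow> ratfun"

definition Umod :: "nat \<Rightarrow> nat \<Rightarrow> nat list list \<Rightarrow> vect set" where
  "Umod m n lam = {u. (\<forall>X\<in>standard_tableaux n lam. u X \<in> ground_ring m n) \<and>
     (\<forall>X. X \<notin> standard_tableaux n lam \<longrightarrow> u X = 0)}"

text \<open>The basis vector of a standard tableau; the zero vector for a nonstandard one.\<close>

definition bvec :: "nat \<Rightarrow> nat list list \<Rightarrow> tableau \<Rightarrow> vect" where
  "bvec n lam X = (\<lambda>Y. if Y = X \<and> X \<in> standard_tableaux n lam then 1 else 0)"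

text \<open>
  \<open>act\<close> makes \<open>Umod m n lam\<close> a left module over the algebra \<open>hecke m n\<close>, compatibly with the
  \<open>ground_ring m n\<close>-module structure, with the prescribed action of the generators on the basis.
\<close>

definition hecke_action ::
    "nat \<Rightarrow> nat \<Rightarrow> nat list list \<Rightarrow> ((word \<Rightarrow>\<^sub>0 ratfun) set \<Rightarrow> vect \<Rightarrow> vect) \<Rightarrow> bool" where
  "hecke_action m n lam act \<longleftrightarrow>
    (\<forall>h\<in>carrier (hecke m n). \<forall>x\<in>Umod m n lam. act h x \<in> Umod m n lam) \<and>
    (\<forall>h\<in>carrier (hecke m n). \<forall>x\<in>Umod m n lam. \<forall>y\<in>Umod m n lam.
       act h (\<lambda>Y. x Y + y Y) = (\<lambda>Y. act h x Y + act h y Y)) \<and>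
    (\<forall>h\<in>carrier (hecke m n). \<forall>r\<in>ground_ring m n. \<forall>x\<in>Umod m n lam.
       act h (\<lambda>Y. r * x Y) = (\<lambda>Y. r * act h x Y)) \<and>
    (\<forall>g\<in>carrier (hecke m n). \<forall>h\<in>carrier (hecke m n). \<forall>x\<in>Umod m n lam.
       act (g \<oplus>\<^bsub>hecke m n\<^esub> h) x = (\<lambda>Y. act g x Y + act h x Y) \<and>
       act (g \<otimes>\<^bsub>hecke m n\<^esub> h) x = act g (act h x)) \<and>
    (\<forall>x\<in>Umod m n lam. act \<one>\<^bsub>hecke m n\<^esub> x = x) \<and>
    (\<forall>r\<in>ground_ring m n. \<forall>x\<in>Umod m n lam. act (hscal m n r) x = (\<lambda>Y. r * x Y)) \<and>
    (\<forall>X\<in>standard_tableaux n lam.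
       act (hgen m n Tau) (bvec n lam X) = (\<lambda>Y. tab_content lam X 1 * bvec n lam X Y)) \<and>
    (\<forall>X\<in>standard_tableaux n lam. \<forall>i\<in>{1..<n}.
       act (hgen m n (Sigma i)) (bvec n lam X) =
         (let c = tab_content lam X i; c' = tab_content lam X (i + 1) in
          (\<lambda>Y. (qvar - inverse qvar) * c' / (c' - c) * bvec n lam X Y
             + (qvar * c' - inverse qvar * c) / (c' - c) * bvec n lam (swap_entries lam i X) Y)))"


section \<open>The sesquilinear forms\<close>

definition form_weight :: "nat \<Rightarrow> nat list list \<Rightarrow> tableau \<Rightarrow> ratfun" where
  "form_weight n lam X =
    (\<Prod>(j, k) \<in> {(j, k). 1 \<le> j \<and> j < k \<and> k \<le> n \<and>
        tab_content lam X j \<noteq> tab_content lam X k \<and>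
        tab_content lam X j \<noteq> tab_content lam X k * qvar powi 2 \<and>
        tab_content lam X j \<noteq> tab_content lam X k * qvar powi (- 2)}.
      (inverse qvar * tab_content lam X j - qvar * tab_content lam X k)
        / (tab_content lam X j - tab_content lam X k))"

text \<open>
  Linear in the first argument, \<open>\<theta>\<close>-semilinear in the second, orthogonal on the basis.
\<close>

definition form :: "(ratfun \<Rightarrow> ratfun) \<Rightarrow> nat \<Rightarrow> nat list list \<Rightarrow> vect \<Rightarrow> vect \<Rightarrow> ratfun" where
  "form \<theta> n lam x y =
    (\<Sum>X\<in>standard_tableaux n lam. x X * \<theta> (y X) * form_weight n lam X)"

lemma form_additive:
  assumes "\<And>a b. \<theta> (a + b) = \<theta> a + \<theta> b"
  shows "form \<theta> n lam (\<lambda>X. x X + x' X) y = form \<theta> n lam x y + form \<theta> n lam x' y"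
    and "form \<theta> n lam x (\<lambda>X. y X + y' X) = form \<theta> n lam x y + form \<theta> n lam x y'"
  by (simp_all add: form_def assms algebra_simps sum.distrib)

lemma form_sesquilinear:
  assumes "\<And>a b. \<theta> (a * b) = \<theta> a * \<theta> b"
  shows "form \<theta> n lam (\<lambda>X. f * x X) (\<lambda>X. g * y X) = f * \<theta> g * form \<theta> n lam x y"
  by (simp add: form_def assms sum_distrib_left algebra_simps)

lemma finite_nodes: "finite (nodes lam)"
proof -
  have "nodes lam \<subseteq> (SIGMA k:{..<length lam}. SIGMA r:{..<length (lam ! k)}. {..<lam ! k ! r})"
    by (auto simp: nodes_def)
  then show ?thesis by (rule finite_subset) auto
qed

lemma finite_standard_tableaux: "finite (standard_tableaux n lam)"
proof -
  have "standard_tableaux n lam \<subseteq> nodes lam \<rightarrow>\<^sub>E {1..n}"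
    by (auto simp: standard_tableaux_def PiE_def dest: bij_betwE)
  then show ?thesis by (rule finite_subset) (simp add: finite_PiE finite_nodes)
qed

lemma form_bvec:
  assumes "X \<in> standard_tableaux n lam" "X' \<in> standard_tableaux n lam" "\<theta> 0 = 0" "\<theta> 1 = 1"
  shows "form \<theta> n lam (bvec n lam X) (bvec n lam X') = (if X = X' then form_weight n lam X else 0)"
proof -
  have "form \<theta> n lam (bvec n lam X) (bvec n lam X')
      = (\<Sum>Y\<in>standard_tableaux n lam. if Y = X then (if X = X' then form_weight n lam X else 0) else 0)"
    unfolding form_def bvec_def using assms by (intro sum.cong) auto
  then show ?thesis using assms by (simp add: finite_standard_tableaux)
qed

end

theory Submission
  imports Defs
begin

text \<open>
  On the basis, \<open>\<sigma>\<^sub>i\<close> is a direct sum of blocks of size one and two. For two standard tableaux that differ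
  by the exchange of \<open>i\<close> and \<open>i + 1\<close>, with contents \<open>c\<close>, \<open>c'\<close>, the block has the diagonal entries
  \<open>a\<close>, \<open>a'\<close> and the off-diagonal entries \<open>b\<close>, \<open>b'\<close>, where \<open>b\<close> and \<open>b'\<close> are exactly the factors of
  the two weights at the pair \<open>(i, i + 1)\<close>; the remaining factors are only permuted. Hence
  \<open>b w' = b' w\<close>, i.e. \<open>\<sigma>\<^sub>i\<close> is self-adjoint for \<open>\<gamma>\<close>, which fixes all these entries. The involutions \<open>\<omega>\<close>
  and \<open>\<varpi>\<close> invert \<open>q\<close> and the contents, so they fix \<open>b\<close> and send \<open>a\<close> to \<open>- a'\<close>, and unitarity of the
  block is the identity \<open>b b' - a a' = 1\<close>. If the exchange does not give a standard tableau, then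
  \<open>i\<close> and \<open>i + 1\<close> occupy neighbouring nodes, \<open>b b' = 0\<close>, and the same identity settles the block of
  size one.
\<close>

section \<open>The ground ring\<close>

lemma lmon_inject: "lmon e = lmon e' \<longleftrightarrow> e = e'"
proof
  assume "lmon e = lmon e'"
  then have "Poly_Mapping.single e (1::complex) = Poly_Mapping.single e' 1"
    by (simp add: lmon_def)
  then have "Poly_Mapping.lookup (Poly_Mapping.single e (1::complex)) e
      = Poly_Mapping.lookup (Poly_Mapping.single e' 1) e"
    by simp
  then show "e = e'"
    by (auto simp: lookup_single when_def split: if_splits)
qed simp

lemma qvar_power_eq_lmon: "qvar ^ i = lmon (Poly_Mapping.single 0 (int i))"
  by (induction i) (simp_all add: lmon_0 qvar_lmon single_add flip: lmon_add)

lemma qvar_powi_eq_lmon: "qvar powi z = lmon (Poly_Mapping.single 0 z)"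
proof (cases "z \<ge> 0")
  case True
  then show ?thesis by (simp add: power_int_def qvar_power_eq_lmon)
next
  case False
  then show ?thesis
    by (simp add: power_int_def power_inverse qvar_power_eq_lmon single_uminus flip: lmon_uminus)
qed

lemma qvar_powi_inject: "qvar powi a = qvar powi b \<longleftrightarrow> a = b"
  unfolding qvar_powi_eq_lmon lmon_inject
  by (metis lookup_single_eq)

text \<open>The exponents of the \<open>v\<close> and of \<open>q\<close> are read off separately,
  so a content remembers exactly the diagram and the diagonal of its node.\<close>

lemma content_inject:
  "vvar k * qvar powi a = vvar l * qvar powi b \<longleftrightarrow> k = l \<and> a = b"
proof
  assume "vvar k * qvar powi a = vvar l * qvar powi b"
  then have *: "Poly_Mapping.single (Suc k) (1::int) + Poly_Mapping.single 0 a
      = Poly_Mapping.single (Suc l) 1 + Poly_Mapping.single 0 b"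
    by (simp add: qvar_powi_eq_lmon vvar_lmon lmon_inject flip: lmon_add)
  have "k = l"
    using arg_cong[OF *, of "\<lambda>p. Poly_Mapping.lookup p (Suc k)"]
    by (auto simp: lookup_add lookup_single when_def split: if_splits)
  moreover have "a = b"
    using arg_cong[OF *, of "\<lambda>p. Poly_Mapping.lookup p 0"]
    by (auto simp: lookup_add lookup_single when_def split: if_splits)
  ultimately show "k = l \<and> a = b" ..
qed simp

section \<open>Laurent polynomials and the denominators\<close>

lemma laurent_ring_iff: "p \<in> laurent_ring m \<longleftrightarrow> Poly_Mapping.keys p \<subseteq> exps m"
  by (auto simp: laurent_ring_def exps_def)

lemma laurent_ring_add: "p \<in> laurent_ring m \<Longrightarrow> p' \<in> laurent_ring m \<Longrightarrow> p + p' \<in> laurent_ring m"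
  using keys_add[of p p'] by (auto simp: laurent_ring_iff)

lemma laurent_ring_uminus: "p \<in> laurent_ring m \<Longrightarrow> - p \<in> laurent_ring m"
  by (auto simp: laurent_ring_iff in_keys_iff subset_iff)

lemma laurent_ring_mult:
  assumes "p \<in> laurent_ring m" "p' \<in> laurent_ring m"
  shows "p * p' \<in> laurent_ring m"
  using assms keys_mult[of p p'] exps_add by (fastforce simp: laurent_ring_iff)

lemma laurent_ring_single: "e \<in> exps m \<Longrightarrow> Poly_Mapping.single e a \<in> laurent_ring m"
  by (auto simp: laurent_ring_iff)

lemma zero_exps: "0 \<in> exps m"
  by (simp add: exps_def)

lemma qvar_exps: "Poly_Mapping.single 0 i \<in> exps m"
  by (auto simp: exps_def)

lemma vvar_exps: "k < m \<Longrightarrow> Poly_Mapping.single (Suc k) i \<in> exps m"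
  by (auto simp: exps_def)

lemma lmon_laurent: "e \<in> exps m \<Longrightarrow> lmon e \<in> to_fract ` laurent_ring m"
  unfolding lmon_def by (intro imageI laurent_ring_single)

lemma to_fract_laurent_add:
  assumes "x \<in> to_fract ` laurent_ring m" "y \<in> to_fract ` laurent_ring m"
  shows "x + y \<in> to_fract ` laurent_ring m"
  using assms by (auto simp: laurent_ring_add simp flip: to_fract_add)

lemma to_fract_laurent_uminus:
  assumes "x \<in> to_fract ` laurent_ring m"
  shows "- x \<in> to_fract ` laurent_ring m"
  using assms by (auto simp: laurent_ring_uminus simp flip: to_fract_uminus)

lemma to_fract_laurent_mult:
  assumes "x \<in> to_fract ` laurent_ring m" "y \<in> to_fract ` laurent_ring m"
  shows "x * y \<in> to_fract ` laurent_ring m"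
  using assms by (auto simp: laurent_ring_mult simp flip: to_fract_mult)

lemma denoms_laurent: "s \<in> denoms m n \<Longrightarrow> s \<in> to_fract ` laurent_ring m"
proof (induction rule: denoms.induct)
  case one
  show ?case using lmon_laurent[OF zero_exps] by (simp add: lmon_0)
next
  case (qsum N)
  show ?case
  proof (induction N)
    case 0
    show ?case using lmon_laurent[OF zero_exps] by (simp add: lmon_0)
  next
    case (Suc N)
    then show ?case
      unfolding sum.atMost_Suc qvar_power_eq_lmon
      by (intro to_fract_laurent_add lmon_laurent qvar_exps)
  qed
next
  case (vdiff j k i)
  have "lmon (Poly_Mapping.single 0 (2 * i) + Poly_Mapping.single (Suc j) 1)
      + - lmon (Poly_Mapping.single (Suc k) 1) \<in> to_fract ` laurent_ring m"
    using vdiff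
    by (intro to_fract_laurent_add to_fract_laurent_uminus lmon_laurent exps_add qvar_exps vvar_exps)
  then show ?case by (simp add: qvar_powi_eq_lmon vvar_lmon lmon_add)
qed (rule to_fract_laurent_mult)

text \<open>A sum of powers of \<open>q^2\<close> is geometric: multiplied by \<open>q^2 - 1\<close>
  it becomes a nontrivial power of \<open>q\<close> minus 1, and \<open>q\<close> is not a root of
  unity. In the second kind of generator the two monomials involve different parameters.\<close>

lemma denoms_nonzero: "s \<in> denoms m n \<Longrightarrow> s \<noteq> 0"
proof (induction rule: denoms.induct)
  case (qsum N)
  have "(qvar\<^sup>2 - 1) * (\<Sum>i<Suc N. (qvar\<^sup>2) ^ i) = (qvar\<^sup>2) ^ Suc N - 1"
    by (rule power_diff_1_eq[symmetric])
  moreover have "(qvar\<^sup>2) ^ Suc N \<noteq> 1"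
    using qvar_powi_inject[of "int (2 * Suc N)" 0]
    unfolding power_int_of_nat power_mult by simp
  ultimately show ?case
    by (auto simp: power_mult lessThan_Suc_atMost)
next
  case (vdiff j k i)
  then show ?case using content_inject[of j "2 * i" k 0] by (simp add: mult.commute)
qed auto

section \<open>The localization as a subring of the fraction field\<close>

lemma ground_ring_laurent: "x \<in> to_fract ` laurent_ring m \<Longrightarrow> x \<in> ground_ring m n"
  unfolding ground_ring_def using denoms.one by force

lemma ground_ring_lmon: "e \<in> exps m \<Longrightarrow> lmon e \<in> ground_ring m n"
  by (intro ground_ring_laurent lmon_laurent)

lemma ground_ringE:
  assumes "x \<in> ground_ring m n"
  obtains a s where "x = a / s" "a \<in> to_fract ` laurent_ring m" "s \<in> denoms m n"
  using assms unfolding ground_ring_def by blast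

lemma ground_ringI:
  "x = a / s \<Longrightarrow> a \<in> to_fract ` laurent_ring m \<Longrightarrow> s \<in> denoms m n \<Longrightarrow> x \<in> ground_ring m n"
  unfolding ground_ring_def by blast

lemma ground_ring_add:
  assumes "x \<in> ground_ring m n" "y \<in> ground_ring m n"
  shows "x + y \<in> ground_ring m n"
proof -
  obtain a s where x: "x = a / s" "a \<in> to_fract ` laurent_ring m" "s \<in> denoms m n"
    using assms(1) by (rule ground_ringE)
  obtain b t where y: "y = b / t" "b \<in> to_fract ` laurent_ring m" "t \<in> denoms m n"
    using assms(2) by (rule ground_ringE)
  have "x + y = (a * t + b * s) / (s * t)"
    using x y denoms_nonzero[of s m n] denoms_nonzero[of t m n] by (simp add: add_frac_eq)
  then show ?thesis
    using x y denoms_laurent[of s] denoms_laurent[of t]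
    by (intro ground_ringI[of _ "a * t + b * s" "s * t"] to_fract_laurent_add
        to_fract_laurent_mult denoms.mult)
qed

lemma ground_ring_mult:
  assumes "x \<in> ground_ring m n" "y \<in> ground_ring m n"
  shows "x * y \<in> ground_ring m n"
proof -
  obtain a s where x: "x = a / s" "a \<in> to_fract ` laurent_ring m" "s \<in> denoms m n"
    using assms(1) by (rule ground_ringE)
  obtain b t where y: "y = b / t" "b \<in> to_fract ` laurent_ring m" "t \<in> denoms m n"
    using assms(2) by (rule ground_ringE)
  show ?thesis
    using x y by (intro ground_ringI[of _ "a * b" "s * t"] to_fract_laurent_mult denoms.mult) simp_all
qed

lemma ground_ring_uminus: "x \<in> ground_ring m n \<Longrightarrow> - x \<in> ground_ring m n"
  by (erule ground_ringE, rule ground_ringI[OF _ to_fract_laurent_uminus]) simp_all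

lemma ground_ring_0: "0 \<in> ground_ring m n"
  using ground_ring_laurent[of "to_fract 0"] by (force simp: laurent_ring_def)

lemma ground_ring_1: "1 \<in> ground_ring m n"
  using ground_ring_lmon[OF zero_exps] by (simp add: lmon_0)

lemma ground_ring_qvar: "qvar \<in> ground_ring m n"
  unfolding qvar_lmon by (intro ground_ring_lmon qvar_exps)

lemma ground_ring_inverse_qvar: "inverse qvar \<in> ground_ring m n"
  unfolding qvar_lmon lmon_uminus[symmetric] by (intro ground_ring_lmon exps_uminus qvar_exps)

lemma ground_ring_vvar: "k < m \<Longrightarrow> vvar k \<in> ground_ring m n"
  by (simp add: vvar_lmon ground_ring_lmon vvar_exps)

lemma ground_ring_inverse_vvar: "k < m \<Longrightarrow> inverse (vvar k) \<in> ground_ring m n"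
  by (simp add: vvar_lmon ground_ring_lmon vvar_exps exps_uminus flip: lmon_uminus)

section \<open>The generators of the cyclotomic Hecke algebra are units\<close>

lemma free_algebra_simps [simp]:
  "x \<otimes>\<^bsub>free_algebra m n\<^esub> y = x * y" "x \<oplus>\<^bsub>free_algebra m n\<^esub> y = x + y"
  "\<one>\<^bsub>free_algebra m n\<^esub> = 1" "\<zero>\<^bsub>free_algebra m n\<^esub> = 0"
  by (simp_all add: free_algebra_def)

lemma free_algebra_carrier_iff:
  "p \<in> carrier (free_algebra m n) \<longleftrightarrow> (\<forall>w\<in>Poly_Mapping.keys p.
     Poly_Mapping.lookup p w \<in> ground_ring m n \<and> set (letters w) \<subseteq> gens n)"
  by (simp add: free_algebra_def)

lemma free_algebra_single:
  "r \<in> ground_ring m n \<Longrightarrow> set (letters w) \<subseteq> gens n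
    \<Longrightarrow> Poly_Mapping.single w r \<in> carrier (free_algebra m n)"
  by (auto simp: free_algebra_carrier_iff)

lemma free_algebra_0: "0 \<in> carrier (free_algebra m n)"
  by (simp add: free_algebra_carrier_iff)

lemma free_algebra_add:
  assumes "p \<in> carrier (free_algebra m n)" "p' \<in> carrier (free_algebra m n)"
  shows "p + p' \<in> carrier (free_algebra m n)"
proof -
  \<comment> \<open>Coefficients off the support are 0 and hence also in the ground ring, which
    covers words occurring in only one summand.\<close>
  have coeff: "Poly_Mapping.lookup x w \<in> ground_ring m n" if "x \<in> carrier (free_algebra m n)" for x w
    using that ground_ring_0
    by (cases "w \<in> Poly_Mapping.keys x") (auto simp: free_algebra_carrier_iff in_keys_iff)
  show ?thesis
    using assms keys_add[of p p'] coeff[OF assms(1)] coeff[OF assms(2)]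
    by (auto simp: free_algebra_carrier_iff lookup_add intro!: ground_ring_add)
qed

lemma free_algebra_uminus:
  "p \<in> carrier (free_algebra m n) \<Longrightarrow> - p \<in> carrier (free_algebra m n)"
  by (auto simp: free_algebra_carrier_iff in_keys_iff intro: ground_ring_uminus)

lemma free_algebra_diff:
  "p \<in> carrier (free_algebra m n) \<Longrightarrow> p' \<in> carrier (free_algebra m n)
    \<Longrightarrow> p - p' \<in> carrier (free_algebra m n)"
  using free_algebra_add[of p m n "- p'"] free_algebra_uminus[of p'] by simp

lemma free_algebra_sum:
  "(\<And>i. i \<in> A \<Longrightarrow> f i \<in> carrier (free_algebra m n)) \<Longrightarrow> sum f A \<in> carrier (free_algebra m n)"
  by (induction A rule: infinite_finite_induct) (auto simp: free_algebra_0 intro: free_algebra_add)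

text \<open>Expanding both factors into single words reduces the claim to concatenating words and
  multiplying coefficients.\<close>

lemma free_algebra_mult:
  assumes "p \<in> carrier (free_algebra m n)" "p' \<in> carrier (free_algebra m n)"
  shows "p * p' \<in> carrier (free_algebra m n)"
proof -
  have sum: "x = (\<Sum>w\<in>Poly_Mapping.keys x. Poly_Mapping.single w (Poly_Mapping.lookup x w))"
    for x :: "word \<Rightarrow>\<^sub>0 ratfun"
    by (rule poly_mapping_eqI)
      (simp add: lookup_sum lookup_single when_def in_keys_iff)
  have "p * p' = (\<Sum>w\<in>Poly_Mapping.keys p. \<Sum>w'\<in>Poly_Mapping.keys p'.
      Poly_Mapping.single (w + w') (Poly_Mapping.lookup p w * Poly_Mapping.lookup p' w'))"
    by (subst sum[of p], subst sum[of p']) (simp add: sum_product mult_single)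
  also have "\<dots> \<in> carrier (free_algebra m n)"
    using assms
    by (intro free_algebra_sum free_algebra_single ground_ring_mult)
      (auto simp: free_algebra_carrier_iff plus_word_def)
  finally show ?thesis .
qed

lemma free_algebra_scal: "r \<in> ground_ring m n \<Longrightarrow> scal r \<in> carrier (free_algebra m n)"
  unfolding scal_def by (rule free_algebra_single) (auto simp: zero_word_def)

lemma scal_1: "scal 1 = 1"
  by (simp add: scal_def)

lemma scal_mult: "scal (r * s) = scal r * scal s"
  by (simp add: scal_def mult_single)

lemma scal_uminus: "scal (- r) = - scal r"
  by (simp add: scal_def single_uminus)

lemma free_algebra_1: "1 \<in> carrier (free_algebra m n)"
  using free_algebra_scal[OF ground_ring_1] by (simp add: scal_1)

lemma free_algebra_gword: "set w \<subseteq> gens n \<Longrightarrow> gword w \<in> carrier (free_algebra m n)"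
  unfolding gword_def by (rule free_algebra_single) (auto simp: ground_ring_1)

text \<open>Scalars sit on the empty word, which is neutral for concatenation, and coefficients
  commute.\<close>

lemma scal_commute: "scal r * p = p * scal r"
proof (induction p rule: single_plus_induct)
  case (2 p e a)
  then show ?case by (simp add: distrib_left distrib_right scal_def mult_single mult.commute)
qed simp

lemma ring_free_algebra: "ring (free_algebra m n)"
proof (intro ringI abelian_groupI monoidI)
  fix x assume "x \<in> carrier (free_algebra m n)"
  then show "\<exists>y\<in>carrier (free_algebra m n). y \<oplus>\<^bsub>free_algebra m n\<^esub> x = \<zero>\<^bsub>free_algebra m n\<^esub>"
    by (intro bexI[of _ "- x"]) (simp_all add: free_algebra_uminus)
qed (simp_all add: free_algebra_add free_algebra_mult free_algebra_0 free_algebra_1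
    algebra_simps)

lemma hecke_relators_subset: "hecke_relators m n \<subseteq> carrier (free_algebra m n)"
proof -
  have T: "Tau \<in> gens n" and S: "\<And>i. 1 \<le> i \<Longrightarrow> i < n \<Longrightarrow> Sigma i \<in> gens n"
    by (auto simp: gens_def)
  \<comment> \<open>Prefixes of the product allow induction; the bound \<open>l \<le> m\<close>
    keeps the parameters inside the ground ring.\<close>
  have "prod_list (map (\<lambda>k. gword [Tau] - scal (vvar k)) [0..<l]) \<in> carrier (free_algebra m n)"
    if "l \<le> m" for l
    using that
    by (induction l) (auto intro!: free_algebra_1 free_algebra_mult free_algebra_diff
        free_algebra_gword free_algebra_scal ground_ring_vvar simp: T)
  moreover have "qvar - inverse qvar \<in> ground_ring m n"
    using ground_ring_add[OF ground_ring_qvar ground_ring_uminus[OF ground_ring_inverse_qvar]] by simp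
  ultimately show ?thesis
    unfolding hecke_relators_def
    by (auto intro!: free_algebra_1 free_algebra_mult free_algebra_diff
        free_algebra_gword free_algebra_scal T S)
qed

section \<open>The quotient by the defining relations and its units\<close>

lemma ideal_hecke_ideal: "ideal (hecke_ideal m n) (free_algebra m n)"
  unfolding hecke_ideal_def
  by (rule ring.genideal_ideal[OF ring_free_algebra hecke_relators_subset])

lemma ring_hecke: "ring (hecke m n)"
  unfolding hecke_def by (rule ideal.quotient_is_ring[OF ideal_hecke_ideal])

lemma hecke_relators_ideal: "hecke_relators m n \<subseteq> hecke_ideal m n"
  unfolding hecke_ideal_def
  by (rule ring.genideal_self[OF ring_free_algebra hecke_relators_subset])

lemma hgen_closed: "a \<in> gens n \<Longrightarrow> hgen m n a \<in> carrier (hecke m n)"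
  using ring_hom_closed[OF ideal.rcos_ring_hom[OF ideal_hecke_ideal], of "gword [a]" m n]
  by (simp add: hgen_def hecke_def free_algebra_gword)

text \<open>This moves the construction of inverses to the free algebra. Both products are checked,
  as the algebra is not commutative.\<close>

lemma unit_in_hecke:
  assumes "p \<in> carrier (free_algebra m n)" "p' \<in> carrier (free_algebra m n)"
    and "p * p' - 1 \<in> hecke_ideal m n" "p' * p - 1 \<in> hecke_ideal m n"
  shows "hecke_ideal m n +>\<^bsub>free_algebra m n\<^esub> p \<in> Units (hecke m n)"
proof -
  interpret I: ideal "hecke_ideal m n" "free_algebra m n" by (rule ideal_hecke_ideal)
  define \<phi> where "\<phi> = (+>\<^bsub>free_algebra m n\<^esub>) (hecke_ideal m n)"
  have hom: "\<phi> \<in> ring_hom (free_algebra m n) (hecke m n)"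
    unfolding \<phi>_def hecke_def by (rule I.rcos_ring_hom)
  have "\<phi> x \<otimes>\<^bsub>hecke m n\<^esub> \<phi> y = \<one>\<^bsub>hecke m n\<^esub>"
    if "x \<in> carrier (free_algebra m n)" "y \<in> carrier (free_algebra m n)"
      "x * y - 1 \<in> hecke_ideal m n" for x y
  proof -
    \<comment> \<open>Splitting off 1 leaves a summand in the ideal, which the projection
      kills.\<close>
    have "\<phi> x \<otimes>\<^bsub>hecke m n\<^esub> \<phi> y = \<phi> ((x * y - 1) + 1)"
      using ring_hom_mult[OF hom that(1,2)] by simp
    also have "\<dots> = \<phi> (x * y - 1) \<oplus>\<^bsub>hecke m n\<^esub> \<phi> 1"
      using ring_hom_add[OF hom, of "x * y - 1" 1] that
      by (simp add: free_algebra_diff free_algebra_mult free_algebra_1)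
    also have "\<phi> (x * y - 1) = \<zero>\<^bsub>hecke m n\<^esub>"
      using I.a_rcos_const that(3) by (simp add: \<phi>_def hecke_def FactRing_def)
    also have "\<phi> 1 = \<one>\<^bsub>hecke m n\<^esub>"
      using ring_hom_one[OF hom] by simp
    finally show ?thesis
      using ring.ring_simprules(8)[OF ring_hecke] ring.ring_simprules(6)[OF ring_hecke] by simp
  qed
  then show ?thesis
    using assms ring_hom_closed[OF hom] unfolding Units_def \<phi>_def[symmetric] by blast
qed

text \<open>The quadratic relation says \<open>\<sigma>\<^sub>i (\<sigma>\<^sub>i - (q - q\<inverse>)) = 1\<close>.\<close>

lemma sigma_unit:
  assumes "1 \<le> i" "i < n"
  shows "hgen m n (Sigma i) \<in> Units (hecke m n)"
proof -
  define k where "k = qvar - inverse qvar"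
  define s where "s = gword [Sigma i]"
  have k: "k \<in> ground_ring m n"
    unfolding k_def
    using ground_ring_add[OF ground_ring_qvar ground_ring_uminus[OF ground_ring_inverse_qvar]] by simp
  have s: "s \<in> carrier (free_algebra m n)"
    unfolding s_def using assms by (intro free_algebra_gword) (auto simp: gens_def)
  have "s * s = gword [Sigma i, Sigma i]"
    by (simp add: s_def gword_def mult_single plus_word_def)
  moreover have "gword [Sigma i, Sigma i] - scal k * s - 1 \<in> hecke_relators m n"
    unfolding hecke_relators_def k_def s_def using assms by blast
  ultimately have rel: "s * s - scal k * s - 1 \<in> hecke_ideal m n"
    using hecke_relators_ideal by auto
  show ?thesis
    unfolding hgen_def s_def[symmetric]
  proof (rule unit_in_hecke[OF s, of "s - scal k"])
    show "s - scal k \<in> carrier (free_algebra m n)"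
      by (intro free_algebra_diff s free_algebra_scal k)
  qed (use rel in \<open>simp_all add: right_diff_distrib left_diff_distrib scal_commute\<close>)
qed

text \<open>Modulo \<open>\<tau>\<close>, the cyclotomic relator is the invertible scalar \<open>\<Prod>\<^sub>k (- v\<^sub>k)\<close>.\<close>

lemma cyclotomic_relator_decomp:
  assumes "l \<le> m"
  shows "\<exists>b\<in>carrier (free_algebra m n). \<exists>c. c \<in> ground_ring m n \<and> inverse c \<in> ground_ring m n \<and> c \<noteq> 0 \<and>
    gword [Tau] * b = b * gword [Tau] \<and>
    prod_list (map (\<lambda>k. gword [Tau] - scal (vvar k)) [0..<l]) = gword [Tau] * b + scal c"
  using assms
proof (induction l)
  case 0
  show ?case
    by (intro bexI[of _ 0] exI[of _ 1]) (simp_all add: free_algebra_0 ground_ring_1 scal_1)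
next
  case (Suc l)
  define T where "T = gword [Tau]"
  define v where "v = vvar l"
  obtain b c where b: "b \<in> carrier (free_algebra m n)"
    and c: "c \<in> ground_ring m n" "inverse c \<in> ground_ring m n" "c \<noteq> 0"
    and comm: "T * b = b * T"
    and prod: "prod_list (map (\<lambda>k. T - scal (vvar k)) [0..<l]) = T * b + scal c"
    using Suc unfolding T_def by auto
  have T: "T \<in> carrier (free_algebra m n)"
    unfolding T_def by (rule free_algebra_gword) (simp add: gens_def)
  have v: "v \<in> ground_ring m n" "inverse v \<in> ground_ring m n" "v \<noteq> 0"
    unfolding v_def using Suc.prems by (simp_all add: ground_ring_vvar ground_ring_inverse_vvar)
  \<comment> \<open>A further factor \<open>T - v\<close> turns \<open>T b + c\<close> into
    \<open>T (b (T - v) + c) - c v\<close>, which yields the witnesses. The new cofactor still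
    commutes with \<open>T\<close>, and the new constant stays invertible because \<open>v\<close>
    is.\<close>
  have "T * (b * (T - scal v) + scal c) = (b * (T - scal v) + scal c) * T"
    by (simp add: distrib_left distrib_right left_diff_distrib right_diff_distrib
        scal_commute[of v] scal_commute[of c] comm mult.assoc)
      (simp add: comm flip: mult.assoc)
  moreover have "(T * b + scal c) * (T - scal v)
      = T * (b * (T - scal v) + scal c) + scal (- (c * v))"
    by (simp add: distrib_left distrib_right left_diff_distrib right_diff_distrib
        scal_commute[of c T] scal_mult scal_uminus mult.assoc)
  moreover have "b * (T - scal v) + scal c \<in> carrier (free_algebra m n)"
    using b c v T by (intro free_algebra_add free_algebra_mult free_algebra_diff free_algebra_scal)
  moreover have "- (c * v) \<in> ground_ring m n" "inverse (- (c * v)) \<in> ground_ring m n"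
    using c v by (auto intro!: ground_ring_uminus ground_ring_mult )
  ultimately show ?case
    using c v prod
    by (intro bexI[of _ "b * (T - scal v) + scal c"] exI[of _ "- (c * v)"])
      (simp_all add: T_def v_def)
qed

text \<open>The relator \<open>T b + c\<close> vanishes in the quotient, so \<open>- b / c\<close>
  is a right inverse of \<open>T\<close>; it is also a left inverse because \<open>b\<close>
  commutes with \<open>T\<close>.\<close>

lemma tau_unit: "hgen m n Tau \<in> Units (hecke m n)"
proof -
  interpret I: ideal "hecke_ideal m n" "free_algebra m n" by (rule ideal_hecke_ideal)
  define T where "T = gword [Tau]"
  obtain b c where b: "b \<in> carrier (free_algebra m n)"
    and c: "c \<in> ground_ring m n" "inverse c \<in> ground_ring m n" "c \<noteq> 0"
    and comm: "T * b = b * T"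
    and prod: "prod_list (map (\<lambda>k. T - scal (vvar k)) [0..<m]) = T * b + scal c"
    using cyclotomic_relator_decomp[of m m n] unfolding T_def by auto
  define r where "r = scal (- inverse c)"
  have r: "r \<in> carrier (free_algebra m n)"
    unfolding r_def using c by (intro free_algebra_scal ground_ring_uminus)
  have T: "T \<in> carrier (free_algebra m n)"
    unfolding T_def by (rule free_algebra_gword) (simp add: gens_def)
  have "prod_list (map (\<lambda>k. T - scal (vvar k)) [0..<m]) \<in> hecke_relators m n"
    unfolding hecke_relators_def T_def by (intro UnI2 singletonI)
  then have "T * b + scal c \<in> hecke_ideal m n"
    unfolding prod using hecke_relators_ideal by blast
  then have "(T * b + scal c) * r \<in> hecke_ideal m n"
    using I.I_r_closed[OF _ r] by simp
  moreover have "scal c * r = - 1"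
    using c by (simp add: r_def scal_1 scal_uminus flip: scal_mult)
  ultimately have rel: "T * (b * r) - 1 \<in> hecke_ideal m n"
    by (simp add: distrib_right mult.assoc)
  moreover have "b * r * T = T * (b * r)"
    by (simp add: r_def comm mult.assoc scal_commute) (simp add: comm flip: mult.assoc)
  ultimately show ?thesis
    unfolding hgen_def T_def[symmetric]
    by (intro unit_in_hecke[OF T, of "b * r"] free_algebra_mult b r) simp_all
qed

lemma hgen_unit: "a \<in> gens n \<Longrightarrow> hgen m n a \<in> Units (hecke m n)"
  using tau_unit sigma_unit by (auto simp: gens_def)

section \<open>Contents of standard tableaux and weights\<close>

lemma nodes_downward:
  assumes "is_multipartition m n lam" "(k, r, s) \<in> nodes lam" "r' \<le> r" "s' \<le> s"
  shows "(k, r', s') \<in> nodes lam"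
proof -
  have k: "k < length lam" "r < length (lam ! k)" "s < lam ! k ! r"
    using assms(2) by (auto simp: nodes_def)
  then have "sorted_wrt (\<ge>) (lam ! k)"
    using assms(1) by (auto simp: is_multipartition_def is_partition_def)
  then have "lam ! k ! r \<le> lam ! k ! r'"
    using k assms(3) sorted_wrt_nth_less[of "(\<ge>)" "lam ! k" r' r] by (cases "r' = r") auto
  then show ?thesis using k assms by (auto simp: nodes_def)
qed

text \<open>Walk along row \<open>r\<close> to column \<open>s'\<close> and then down to row
  \<open>r'\<close>; the corner is a node because diagrams are closed under moving up and
  left.\<close>

lemma standard_strict_mono:
  assumes lam: "is_multipartition m n lam" and X: "X \<in> standard_tableaux n lam"
    and nodes: "(k, r, s) \<in> nodes lam" "(k, r', s') \<in> nodes lam"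
    and le: "r \<le> r'" "s \<le> s'" "(r, s) \<noteq> (r', s')"
  shows "X (k, r, s) < X (k, r', s')"
proof -
  have corner: "(k, r, s') \<in> nodes lam"
    using nodes_downward[OF lam nodes(2)] le by blast
  have row: "X (k, r, s) < X (k, r, s')" if "s < s'"
    using X nodes corner that unfolding standard_tableaux_def by blast
  have col: "X (k, r, s') < X (k, r', s')" if "r < r'"
    using X nodes corner that unfolding standard_tableaux_def by blast
  consider "s < s'" "r < r'" | "s < s'" "r = r'" | "s = s'" "r < r'"
    using le by force
  then show ?thesis using row col by cases auto
qed

lemma standard_bij: "X \<in> standard_tableaux n lam \<Longrightarrow> bij_betw X (nodes lam) {1..n}"
  by (simp add: standard_tableaux_def)

lemma entry_node:
  assumes "X \<in> standard_tableaux n lam" "i \<in> {1..n}"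
  shows "the_inv_into (nodes lam) X i \<in> nodes lam" "X (the_inv_into (nodes lam) X i) = i"
  using f_the_inv_into_f_bij_betw[OF standard_bij[OF assms(1)]] assms(2)
    bij_betwE[OF bij_betw_the_inv_into[OF standard_bij[OF assms(1)]]] by auto

lemma tab_content_entry:
  assumes "X \<in> standard_tableaux n lam" "\<alpha> \<in> nodes lam"
  shows "tab_content lam X (X \<alpha>) = node_content \<alpha>"
  using the_inv_into_f_f[OF bij_betw_imp_inj_on[OF standard_bij[OF assms(1)]] assms(2)]
  by (simp add: tab_content_def)

text \<open>Bijectivity survives every exchange, so standardness can fail only through monotonicity
  along a row or a column.\<close>

lemma swap_entries_bij:
  assumes "X \<in> standard_tableaux n lam" "i \<in> {1..<n}"
  shows "bij_betw (swap_entries lam i X) (nodes lam) {1..n}"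
proof -
  have "bij_betw (Transposition.transpose i (i + 1)) {1..n} {1..n}"
    using assms(2) by (intro bij_betw_transpose_iff) auto
  then have "bij_betw (Transposition.transpose i (i + 1) \<circ> X) (nodes lam) {1..n}"
    by (rule bij_betw_trans[OF standard_bij[OF assms(1)]])
  then show ?thesis
    unfolding swap_entries_def by (subst bij_betw_cong[of _ _ "Transposition.transpose i (i + 1) \<circ> X"]) auto
qed

lemma tab_content_swap:
  assumes X: "X \<in> standard_tableaux n lam" and i: "i \<in> {1..<n}" and j: "j \<in> {1..n}"
  shows "tab_content lam (swap_entries lam i X) j
    = tab_content lam X (Transposition.transpose i (i + 1) j)"
proof -
  define t where "t = Transposition.transpose i (i + 1)"
  define \<alpha> where "\<alpha> = the_inv_into (nodes lam) X (t j)"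
  have "t j \<in> {1..n}" using i j by (auto simp: t_def Transposition.transpose_def)
  then have \<alpha>: "\<alpha> \<in> nodes lam" "X \<alpha> = t j"
    unfolding \<alpha>_def using entry_node[OF X] by blast+
  have "swap_entries lam i X \<alpha> = j"
    using \<alpha> by (simp add: swap_entries_def t_def)
  then have "the_inv_into (nodes lam) (swap_entries lam i X) j = \<alpha>"
    using \<alpha> bij_betw_imp_inj_on[OF swap_entries_bij[OF X i]] the_inv_into_f_f by metis
  then show ?thesis by (simp add: tab_content_def \<alpha>_def t_def)
qed

lemma swap_entries_involutive:
  assumes "X \<in> standard_tableaux n lam"
  shows "swap_entries lam i (swap_entries lam i X) = X"
proof (rule extensionalityI)
  show "swap_entries lam i (swap_entries lam i X) \<in> extensional (nodes lam)"
    by (simp add: swap_entries_def)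
  show "X \<in> extensional (nodes lam)"
    using assms by (simp add: standard_tableaux_def)
qed (simp add: swap_entries_def)

text \<open>
  Nodes on the same or on adjacent diagonals of a diagram are comparable, so their entries are in
  the same order in all standard tableaux.
\<close>

lemma swap_standard_content:
  assumes lam: "is_multipartition m n lam" and X: "X \<in> standard_tableaux n lam"
    and sX: "swap_entries lam i X \<in> standard_tableaux n lam" and i: "i \<in> {1..<n}"
    and d: "\<bar>d\<bar> \<le> 1"
  shows "tab_content lam X i \<noteq> tab_content lam X (i + 1) * qvar powi (2 * d)"
proof
  assume eq: "tab_content lam X i = tab_content lam X (i + 1) * qvar powi (2 * d)"
  obtain k r s where \<alpha>: "the_inv_into (nodes lam) X i = (k, r, s)" by (metis prod_cases3)
  obtain k' r' s' where \<beta>: "the_inv_into (nodes lam) X (i + 1) = (k', r', s')" by (metis prod_cases3)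
  have \<alpha>n: "(k, r, s) \<in> nodes lam" "X (k, r, s) = i"
    using entry_node[OF X, of i] i \<alpha> by auto
  have \<beta>n: "(k', r', s') \<in> nodes lam" "X (k', r', s') = i + 1"
    using entry_node[OF X, of "i + 1"] i \<beta> by auto
  have "vvar k * qvar powi (2 * (int s - int r))
      = vvar k' * qvar powi (2 * (int s' - int r') + 2 * d)"
    using eq unfolding tab_content_def \<alpha> \<beta> node_content_def prod.case
    by (simp add: power_int_add mult.assoc)
  then have k: "k' = k" and diag: "int s - int r = int s' - int r' + d"
    by (auto simp: content_inject)
  have ne: "(r, s) \<noteq> (r', s')" using \<alpha>n \<beta>n k by auto
  \<comment> \<open>Incomparable nodes lie on diagonals at distance at least two. The first order
    contradicts standardness of the exchanged tableau, the second that of \<open>X\<close>.\<close>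
  have "r \<le> r' \<and> s \<le> s' \<or> r' \<le> r \<and> s' \<le> s" using diag d by linarith
  then show False
  proof
    assume "r \<le> r' \<and> s \<le> s'"
    then have "swap_entries lam i X (k, r, s) < swap_entries lam i X (k, r', s')"
      using standard_strict_mono[OF lam sX] \<alpha>n \<beta>n k ne by blast
    then show False using \<alpha>n \<beta>n k by (simp add: swap_entries_def)
  next
    assume "r' \<le> r \<and> s' \<le> s"
    then have "X (k, r', s') < X (k, r, s)"
      using standard_strict_mono[OF lam X] \<alpha>n \<beta>n k ne by metis
    then show False using \<alpha>n \<beta>n k by simp
  qed
qed

text \<open>If exchanging \<open>i\<close> and \<open>i + 1\<close> destroys standardness, these entries occupy neighbouring nodes.\<close>

lemma swap_nonstandard_content:
  assumes lam: "is_multipartition m n lam" and X: "X \<in> standard_tableaux n lam"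
    and sX: "swap_entries lam i X \<notin> standard_tableaux n lam" and i: "i \<in> {1..<n}"
  shows "tab_content lam X (i + 1) = tab_content lam X i * qvar powi 2 \<or>
    tab_content lam X (i + 1) = tab_content lam X i * qvar powi (- 2)"
proof -
  \<comment> \<open>Exchanging two consecutive values reverses the order of no other pair of
    entries.\<close>
  have entries: "X \<alpha> = i \<and> X \<beta> = i + 1"
    if "\<alpha> \<in> nodes lam" "\<beta> \<in> nodes lam" "X \<alpha> < X \<beta>"
      "\<not> swap_entries lam i X \<alpha> < swap_entries lam i X \<beta>" for \<alpha> \<beta>
    using that by (auto simp: swap_entries_def Transposition.transpose_def split: if_splits)
  have "swap_entries lam i X \<in> extensional (nodes lam)"
    by (simp add: swap_entries_def)
  with sX swap_entries_bij[OF X i] consider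
      (row) k r s s' where "(k, r, s) \<in> nodes lam" "(k, r, s') \<in> nodes lam" "s < s'"
        "\<not> swap_entries lam i X (k, r, s) < swap_entries lam i X (k, r, s')"
    | (col) k r r' s where "(k, r, s) \<in> nodes lam" "(k, r', s) \<in> nodes lam" "r < r'"
        "\<not> swap_entries lam i X (k, r, s) < swap_entries lam i X (k, r', s)"
    unfolding standard_tableaux_def by blast
  then show ?thesis
  proof cases
    case row
    have X12: "X (k, r, s) = i" "X (k, r, s') = i + 1"
      using entries[OF row(1,2) _ row(4)] standard_strict_mono[OF lam X row(1,2)] row(3) by auto
    \<comment> \<open>A node in between would carry an integer strictly between \<open>i\<close> and
      \<open>i + 1\<close>.\<close>
    have "s' = s + 1"
    proof (rule ccontr)
      assume "s' \<noteq> s + 1"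
      then have s: "s + 1 < s'" using row by simp
      have n: "(k, r, s + 1) \<in> nodes lam"
        using nodes_downward[OF lam row(2)] s by simp
      show False
        using standard_strict_mono[OF lam X row(1) n] standard_strict_mono[OF lam X n row(2)] s X12
        by simp
    qed
    then have "2 * (int s' - int r) = 2 * (int s - int r) + 2" by simp
    then show ?thesis
      using tab_content_entry[OF X row(1)] tab_content_entry[OF X row(2)] X12
      by (simp only: node_content_def prod.case power_int_add[OF disjI1[OF qvar_nonzero]] mult.assoc
          simp_thms)
  next
    case col
    have X12: "X (k, r, s) = i" "X (k, r', s) = i + 1"
      using entries[OF col(1,2) _ col(4)] standard_strict_mono[OF lam X col(1,2)] col(3) by auto
    have "r' = r + 1"
    proof (rule ccontr)
      assume "r' \<noteq> r + 1"
      then have r: "r + 1 < r'" using col by simp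
      have n: "(k, r + 1, s) \<in> nodes lam"
        using nodes_downward[OF lam col(2)] r by simp
      show False
        using standard_strict_mono[OF lam X col(1) n] standard_strict_mono[OF lam X n col(2)] r X12
        by simp
    qed
    then have "2 * (int s - int r') = 2 * (int s - int r) + - 2" by simp
    then show ?thesis
      using tab_content_entry[OF X col(1)] tab_content_entry[OF X col(2)] X12
      by (simp only: node_content_def prod.case power_int_add[OF disjI1[OF qvar_nonzero]] mult.assoc
          simp_thms)
  qed
qed

section \<open>The weights as products over pairs\<close>

definition weight_factor :: "ratfun \<Rightarrow> ratfun \<Rightarrow> ratfun" where
  "weight_factor c c' = (if c \<noteq> c' \<and> c \<noteq> c' * qvar powi 2 \<and> c \<noteq> c' * qvar powi (- 2)
    then (inverse qvar * c - qvar * c') / (c - c') else 1)"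

text \<open>Excluded pairs contribute 1, so the index set becomes independent of the tableau and the
  product can be reindexed.\<close>

lemma form_weight_eq_prod:
  "form_weight n lam X = (\<Prod>(j, k)\<in>{(j, k). 1 \<le> j \<and> j < k \<and> k \<le> n}.
     weight_factor (tab_content lam X j) (tab_content lam X k))"
proof -
  have fin: "finite {(j::nat, k). 1 \<le> j \<and> j < k \<and> k \<le> n}"
    by (rule finite_subset[of _ "{1..n} \<times> {1..n}"]) auto
  show ?thesis
    unfolding form_weight_def
    by (intro prod.mono_neutral_cong_left fin) (auto simp: weight_factor_def)
qed

lemma form_weight_split:
  assumes "i \<in> {1..<n}"
  shows "form_weight n lam X = weight_factor (tab_content lam X i) (tab_content lam X (i + 1)) *
    (\<Prod>(j, k)\<in>{(j, k). 1 \<le> j \<and> j < k \<and> k \<le> n} - {(i, i + 1)}.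
      weight_factor (tab_content lam X j) (tab_content lam X k))"
proof -
  have "finite {(j::nat, k). 1 \<le> j \<and> j < k \<and> k \<le> n}"
    by (rule finite_subset[of _ "{1..n} \<times> {1..n}"]) auto
  then show ?thesis
    unfolding form_weight_eq_prod using assms by (subst prod.remove[of _ "(i, i + 1)"]) auto
qed

text \<open>
  The exchange of \<open>i\<close> and \<open>i + 1\<close> permutes the factors of the weight other than the one of the
  pair \<open>(i, i + 1)\<close>.
\<close>

lemma form_weight_swap:
  assumes X: "X \<in> standard_tableaux n lam" and i: "i \<in> {1..<n}"
  shows "form_weight n lam X * weight_factor (tab_content lam X (i + 1)) (tab_content lam X i)
    = form_weight n lam (swap_entries lam i X)
      * weight_factor (tab_content lam X i) (tab_content lam X (i + 1))"
proof -
  define P where "P = {(j, k). 1 \<le> j \<and> j < k \<and> k \<le> n} - {(i, i + 1)}"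
  define t where "t = Transposition.transpose i (i + 1)"
  define c where "c = tab_content lam X"
  have c: "tab_content lam (swap_entries lam i X) j = c (t j)" if "j \<in> {1..n}" for j
    unfolding c_def t_def by (rule tab_content_swap[OF X i that])
  \<comment> \<open>The transposition reverses the order only of the removed pair, so it maps
    \<open>P\<close> onto itself.\<close>
  have "(\<Prod>(j, k)\<in>P. weight_factor (c (t j)) (c (t k))) = (\<Prod>(j, k)\<in>P. weight_factor (c j) (c k))"
    using i by (intro prod.reindex_bij_witness[of _ "map_prod t t" "map_prod t t"])
      (auto simp: P_def t_def Transposition.transpose_def split: if_splits)
  moreover have "(\<Prod>(j, k)\<in>P. weight_factor (tab_content lam (swap_entries lam i X) j)
      (tab_content lam (swap_entries lam i X) k)) = (\<Prod>(j, k)\<in>P. weight_factor (c (t j)) (c (t k)))"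
    by (intro prod.cong) (auto simp: P_def c)
  moreover have "tab_content lam (swap_entries lam i X) i = c (i + 1)"
    "tab_content lam (swap_entries lam i X) (i + 1) = c i"
    using c[of i] c[of "i + 1"] i by (auto simp: t_def)
  ultimately show ?thesis
    unfolding form_weight_split[OF i, of lam X] form_weight_split[OF i, of lam "swap_entries lam i X"]
      P_def[symmetric]
    by (simp add: c_def)
qed

section \<open>Invariance of the forms\<close>

locale ratfun_hom =
  fixes \<theta> :: "ratfun \<Rightarrow> ratfun"
  assumes add: "\<theta> (x + y) = \<theta> x + \<theta> y"
    and mult: "\<theta> (x * y) = \<theta> x * \<theta> y"
    and one: "\<theta> 1 = 1"
begin

lemma zero: "\<theta> 0 = 0"
  using add[of 0 0] by (metis add_cancel_right_right)

lemma sum: "\<theta> (sum f A) = (\<Sum>i\<in>A. \<theta> (f i))"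
  by (induction A rule: infinite_finite_induct) (simp_all add: zero add)

lemma diff: "\<theta> (x - y) = \<theta> x - \<theta> y"
  using add[of "x - y" y] by simp

lemma inverse: "\<theta> (inverse x) = inverse (\<theta> x)"
proof (cases "x = 0")
  case False
  then have "\<theta> x * \<theta> (inverse x) = 1" by (simp add: one flip: mult)
  then show ?thesis by (metis inverse_unique)
qed (simp add: zero)

lemma divide: "\<theta> (x / y) = \<theta> x / \<theta> y"
  by (simp add: divide_inverse mult inverse)

end

text \<open>The common behaviour of \<omega> and \<varpi>: complex conjugation is invisible on
  \<open>q\<close> and on contents, so one argument serves for both.\<close>

locale bar_hom = ratfun_hom +
  assumes qvar: "\<theta> qvar = inverse qvar"
    and content: "\<theta> (tab_content lam X i) = inverse (tab_content lam X i)"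

text \<open>An entry that does not occur in the tableau is looked up at an unspecified triple, whose
  content still has this form. Hence the involutions act on contents as expected without side
  conditions.\<close>

lemma tab_content_cases:
  obtains k z where "tab_content lam X i = vvar k * qvar powi z"
proof -
  obtain k r s where "the_inv_into (nodes lam) X i = (k, r, s)" by (metis prod_cases3)
  then have "tab_content lam X i = vvar k * qvar powi (2 * (int s - int r))"
    unfolding tab_content_def node_content_def by simp
  then show thesis by (rule that)
qed

lemma tab_content_nonzero: "tab_content lam X i \<noteq> 0"
  by (rule tab_content_cases[of lam X i]) simp

lemma gamma_content: "gamma_invol (tab_content lam X i) = tab_content lam X i"
  by (rule tab_content_cases[of lam X i]) (simp add: gamma_mult gamma_powi gamma_values)

lemma omega_content: "omega_invol (tab_content lam X i) = inverse (tab_content lam X i)"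
  by (rule tab_content_cases[of lam X i])
    (simp add: omega_mult omega_powi omega_values power_int_inverse)

interpretation gamma: ratfun_hom gamma_invol
  by unfold_locales (simp_all add: gamma_add gamma_mult)

interpretation omega: bar_hom omega_invol
  by unfold_locales (simp_all add: omega_add omega_mult omega_values omega_content)

interpretation varpi: bar_hom varpi_invol
  by unfold_locales (simp_all add: varpi_invol_def gamma_add gamma_mult gamma_values gamma_content
      omega_add omega_mult omega_values omega_content)

section \<open>The matrix entries of the braid generators\<close>

definition diag_coeff :: "ratfun \<Rightarrow> ratfun \<Rightarrow> ratfun" where
  "diag_coeff c c' = (qvar - inverse qvar) * c' / (c' - c)"

definition off_coeff :: "ratfun \<Rightarrow> ratfun \<Rightarrow> ratfun" where
  "off_coeff c c' = (qvar * c' - inverse qvar * c) / (c' - c)"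

text \<open>Numerator and denominator both change sign.\<close>

lemma weight_factor_eq_off_coeff:
  assumes "c \<noteq> c'" "c \<noteq> c' * qvar powi 2" "c \<noteq> c' * qvar powi (- 2)"
  shows "weight_factor c c' = off_coeff c c'"
proof -
  have "(inverse qvar * c - qvar * c') / (c - c') = (qvar * c' - inverse qvar * c) / (c' - c)"
    by (metis minus_diff_eq minus_divide_divide)
  then show ?thesis using assms by (simp add: weight_factor_def off_coeff_def)
qed

text \<open>The block has determinant -1, the product of the roots \<open>q\<close> and
  \<open>- inverse qvar\<close> of the quadratic relation. With \<open>d = c' - c\<close>, both
  products have denominator \<open>- d^2\<close>, and the combined numerator collapses to
  \<open>- q p d^2\<close> where \<open>q p = 1\<close>.\<close>

lemma coeff_norm:
  assumes "c \<noteq> c'"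
  shows "off_coeff c c' * off_coeff c' c - diag_coeff c c' * diag_coeff c' c = 1"
proof -
  define p where "p = inverse qvar"
  have p: "qvar * p = 1" by (simp add: p_def)
  define d where "d = c' - c"
  have d: "d \<noteq> 0" and c': "c' = c + d" and neg: "c - c' = - d" using assms by (simp_all add: d_def)
  have "(qvar * c' - p * c) * (qvar * c - p * c') - (qvar - p) * c' * ((qvar - p) * c)
      = - (qvar * p * (d * d))"
    unfolding c' by (simp add: algebra_simps)
  then have "((qvar * c' - p * c) * (qvar * c - p * c') - (qvar - p) * c' * ((qvar - p) * c))
      / - (d * d) = 1"
    using d by (simp add: p)
  moreover have "off_coeff c c' * off_coeff c' c = (qvar * c' - p * c) * (qvar * c - p * c') / - (d * d)"
    "diag_coeff c c' * diag_coeff c' c = (qvar - p) * c' * ((qvar - p) * c) / - (d * d)"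
    by (simp_all add: off_coeff_def diag_coeff_def neg p_def[symmetric] d_def[symmetric])
  ultimately show ?thesis by (simp only: diff_divide_distrib)
qed

text \<open>One of the two numerators vanishes: that of \<open>off_coeff c' c\<close> if
  \<open>c' = q^2 c\<close>, that of \<open>off_coeff c c'\<close> otherwise.\<close>

lemma off_coeff_neighbours:
  assumes "c' = c * qvar powi 2 \<or> c' = c * qvar powi (- 2)"
  shows "off_coeff c c' * off_coeff c' c = 0"
proof -
  have "qvar powi 2 = qvar * qvar" "qvar powi (- 2) = inverse qvar * inverse qvar"
    by (simp_all add: power_int_minus power2_eq_square)
  then have "qvar * c' - inverse qvar * c = 0 \<or> qvar * c - inverse qvar * c' = 0"
    using assms by auto
  then show ?thesis by (auto simp: off_coeff_def)
qed

lemma neighbours_distinct: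
  assumes "c' = c * qvar powi 2 \<or> c' = c * qvar powi (- 2)" "c \<noteq> 0"
  shows "c \<noteq> c'"
proof
  assume "c = c'"
  with assms have "qvar powi 2 = 1 \<or> qvar powi (- 2) = 1"
    by (metis mult_cancel_left1)
  then show False
    using qvar_powi_inject[of 2 0] qvar_powi_inject[of "- 2" 0] by simp
qed

text \<open>Expanding by \<open>c c'\<close> shows that inverting both contents amounts to
  exchanging them. Free \<open>a\<close> and \<open>b\<close> make this serve both kinds of entries;
  the diagonal one has \<open>b = 0\<close>.\<close>

lemma inverse_quotient:
  fixes c c' :: "'a::field"
  assumes "c \<noteq> 0" "c' \<noteq> 0"
  shows "(a * inverse c' - b * inverse c) / (inverse c' - inverse c) = (a * c - b * c') / (c - c')"
proof -
  have "a * inverse c' - b * inverse c = (a * c - b * c') / (c * c')"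
    "inverse c' - inverse c = (c - c') / (c * c')"
    using assms by (simp_all add: field_simps)
  then show ?thesis using assms by simp
qed

lemma (in bar_hom) off_coeff:
  assumes "\<theta> c = inverse c" "\<theta> c' = inverse c'" "c \<noteq> 0" "c' \<noteq> 0"
  shows "\<theta> (off_coeff c c') = off_coeff c c'"
proof -
  have "\<theta> (off_coeff c c') = (inverse qvar * c - qvar * c') / (c - c')"
    using assms(1,2)
    by (simp add: off_coeff_def divide diff mult inverse qvar inverse_quotient[OF assms(3,4)])
  also have "\<dots> = off_coeff c c'"
    unfolding off_coeff_def by (metis minus_diff_eq minus_divide_divide)
  finally show ?thesis .
qed

lemma (in bar_hom) diag_coeff:
  assumes "\<theta> c = inverse c" "\<theta> c' = inverse c'" "c \<noteq> 0" "c' \<noteq> 0"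
  shows "\<theta> (diag_coeff c c') = - diag_coeff c' c"
proof -
  have "\<theta> (diag_coeff c c') = (inverse qvar - qvar) * c / (c - c')"
    using assms(1,2) inverse_quotient[OF assms(3,4), of "inverse qvar - qvar" 0]
    by (simp add: diag_coeff_def divide diff mult inverse qvar)
  also have "\<dots> = - diag_coeff c' c"
    unfolding diag_coeff_def by (metis minus_diff_eq minus_divide_left mult_minus_left)
  finally show ?thesis .
qed

text \<open>Matrix of \<open>\<sigma>\<^sub>i\<close>: the coordinate at \<open>Y\<close> of the
  image of \<open>X\<close>. A nonstandard exchange drops out once \<open>Y\<close> is restricted to
  standard tableaux.\<close>

definition sigma_coeff :: "nat list list \<Rightarrow> nat \<Rightarrow> tableau \<Rightarrow> tableau \<Rightarrow> ratfun" where
  "sigma_coeff lam i X Y =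
    (if Y = X then diag_coeff (tab_content lam X i) (tab_content lam X (i + 1)) else 0) +
    (if Y = swap_entries lam i X then off_coeff (tab_content lam X i) (tab_content lam X (i + 1)) else 0)"

lemma sum_sigma_coeff:
  assumes "X \<in> standard_tableaux n lam"
  shows "(\<Sum>Z\<in>standard_tableaux n lam. sigma_coeff lam i X Z * f Z)
    = diag_coeff (tab_content lam X i) (tab_content lam X (i + 1)) * f X
      + (if swap_entries lam i X \<in> standard_tableaux n lam
         then off_coeff (tab_content lam X i) (tab_content lam X (i + 1)) * f (swap_entries lam i X)
         else 0)"
  using assms
  by (simp add: sigma_coeff_def distrib_right sum.distrib if_distrib[of "\<lambda>x. x * _"]
      finite_standard_tableaux cong: if_cong)

text \<open>Detailed balance, the reason for the choice of the weights.\<close>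

lemma off_coeff_form_weight:
  assumes lam: "is_multipartition m n lam" and X: "X \<in> standard_tableaux n lam"
    and sX: "swap_entries lam i X \<in> standard_tableaux n lam" and i: "i \<in> {1..<n}"
  shows "off_coeff (tab_content lam X i) (tab_content lam X (i + 1)) * form_weight n lam (swap_entries lam i X)
    = off_coeff (tab_content lam X (i + 1)) (tab_content lam X i) * form_weight n lam X"
proof -
  define c where "c = tab_content lam X i"
  define c' where "c' = tab_content lam X (i + 1)"
  have ne: "c \<noteq> c' * qvar powi (2 * d)" if "\<bar>d\<bar> \<le> 1" for d
    unfolding c_def c'_def by (rule swap_standard_content[OF lam X sX i that])
  have sep: "c \<noteq> c'" "c \<noteq> c' * qvar powi 2" "c \<noteq> c' * qvar powi (- 2)"
    using ne[of 0] ne[of 1] ne[of "- 1"] by auto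
  have "c' \<noteq> c * qvar powi 2" "c' \<noteq> c * qvar powi (- 2)"
    using sep by (auto simp: power_int_def mult.assoc power_inverse)
  then have "weight_factor c' c = off_coeff c' c" "weight_factor c c' = off_coeff c c'"
    using sep weight_factor_eq_off_coeff by auto
  then show ?thesis
    using form_weight_swap[OF X i] by (simp add: c_def c'_def mult.commute)
qed

text \<open>Off the diagonal, entries are nonzero only between a tableau and its exchange, and there
  the claim is detailed balance.\<close>

lemma sigma_coeff_symmetric:
  assumes lam: "is_multipartition m n lam" and i: "i \<in> {1..<n}"
    and X: "X \<in> standard_tableaux n lam" and Y: "Y \<in> standard_tableaux n lam"
  shows "sigma_coeff lam i X Y * form_weight n lam Y = sigma_coeff lam i Y X * form_weight n lam X"
proof (cases "Y = X")
  case False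
  show ?thesis
  proof (cases "Y = swap_entries lam i X")
    case True
    have "X = swap_entries lam i Y"
      using swap_entries_involutive[OF X] True by simp
    moreover have "tab_content lam Y i = tab_content lam X (i + 1)"
      "tab_content lam Y (i + 1) = tab_content lam X i"
      using tab_content_swap[OF X i] i True by auto
    ultimately show ?thesis
      using off_coeff_form_weight[OF lam X _ i] Y False True by (simp add: sigma_coeff_def)
  next
    case neq: False
    then have "X \<noteq> swap_entries lam i Y"
      using swap_entries_involutive[OF Y] by metis
    then show ?thesis using False neq by (simp add: sigma_coeff_def)
  qed
qed simp

lemma (in bar_hom) sigma_coeff_unitary:
  assumes lam: "is_multipartition m n lam" and i: "i \<in> {1..<n}"
    and X: "X \<in> standard_tableaux n lam" and Y: "Y \<in> standard_tableaux n lam"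
  shows "(\<Sum>Z\<in>standard_tableaux n lam. sigma_coeff lam i X Z * \<theta> (sigma_coeff lam i Y Z) * form_weight n lam Z)
    = (if X = Y then form_weight n lam X else 0)"
proof -
  define S where "S = standard_tableaux n lam"
  define w where "w = form_weight n lam"
  define sX where "sX = swap_entries lam i X"
  define c where "c = tab_content lam X i"
  define c' where "c' = tab_content lam X (i + 1)"
  note nz = tab_content_nonzero[of lam X i, folded c_def] tab_content_nonzero[of lam X "i + 1", folded c'_def]
  note bar = content[of lam X i, folded c_def] content[of lam X "i + 1", folded c'_def]
  \<comment> \<open>Row \<open>X\<close> is supported on \<open>X\<close> and its exchange, so at
    most two terms remain.\<close>
  have sum: "(\<Sum>Z\<in>S. sigma_coeff lam i X Z * \<theta> (sigma_coeff lam i Y Z) * w Z)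
    = diag_coeff c c' * (\<theta> (sigma_coeff lam i Y X) * w X)
      + (if sX \<in> S then off_coeff c c' * (\<theta> (sigma_coeff lam i Y sX) * w sX) else 0)"
    unfolding S_def sX_def c_def c'_def mult.assoc by (rule sum_sigma_coeff[OF X])
  have inv: "swap_entries lam i sX = X" "swap_entries lam i Y = sX \<longleftrightarrow> Y = X"
    "swap_entries lam i Y = X \<longleftrightarrow> Y = sX"
    unfolding sX_def using swap_entries_involutive[OF X] swap_entries_involutive[OF Y] by metis+
  show ?thesis
    unfolding S_def[symmetric] w_def[symmetric] sum
  proof (cases "sX \<in> S")
    case False
    then have "Y \<noteq> sX" using Y S_def by auto
    have nb: "c' = c * qvar powi 2 \<or> c' = c * qvar powi (- 2)"
      using swap_nonstandard_content[OF lam X _ i] False by (simp add: c_def c'_def S_def sX_def)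
    then have "c \<noteq> c'" by (rule neighbours_distinct[OF _ nz(1)])
    \<comment> \<open>Block of size one: the product of the off-diagonal coefficients is 0, so the
      determinant identity leaves \<open>- a a' = 1\<close>.\<close>
    then have "diag_coeff c c' * \<theta> (diag_coeff c c') = 1"
      using coeff_norm[of c c'] off_coeff_neighbours[OF nb] diag_coeff[OF bar nz] by simp
    moreover have "sX \<noteq> X" using False X S_def by auto
    then have "sigma_coeff lam i Y X = (if X = Y then diag_coeff c c' else 0)"
      using \<open>Y \<noteq> sX\<close> inv by (auto simp: sigma_coeff_def c_def c'_def sX_def)
    ultimately show "diag_coeff c c' * (\<theta> (sigma_coeff lam i Y X) * w X)
      + (if sX \<in> S then off_coeff c c' * (\<theta> (sigma_coeff lam i Y sX) * w sX) else 0)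
      = (if X = Y then w X else 0)"
      using False by (simp add: zero flip: mult.assoc)
  next
    case True
    have ne: "c \<noteq> c'"
      using swap_standard_content[OF lam X _ i, of 0] True by (simp add: c_def c'_def S_def sX_def)
    have csX: "tab_content lam sX i = c'" "tab_content lam sX (i + 1) = c"
      using tab_content_swap[OF X i] i by (auto simp: sX_def c_def c'_def)
    have "sX \<noteq> X" using csX ne by (auto simp: c_def)
    have bal: "off_coeff c c' * w sX = off_coeff c' c * w X"
      using off_coeff_form_weight[OF lam X _ i] True by (simp add: w_def sX_def c_def c'_def S_def)
    consider "Y = X" | "Y = sX" | "Y \<noteq> X" "Y \<noteq> sX" by blast
    then show "diag_coeff c c' * (\<theta> (sigma_coeff lam i Y X) * w X)
      + (if sX \<in> S then off_coeff c c' * (\<theta> (sigma_coeff lam i Y sX) * w sX) else 0)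
      = (if X = Y then w X else 0)"
    proof cases
      case 1
      have "sigma_coeff lam i X X = diag_coeff c c'" "sigma_coeff lam i X sX = off_coeff c c'"
        using \<open>sX \<noteq> X\<close> by (auto simp: sigma_coeff_def c_def c'_def sX_def)
      \<comment> \<open>Balance replaces \<open>b b w sX\<close> by \<open>b b' w X\<close>, which
        exposes the determinant.\<close>
      moreover have "diag_coeff c c' * (\<theta> (diag_coeff c c') * w X) + off_coeff c c' * (off_coeff c c' * w sX)
        = (off_coeff c c' * off_coeff c' c - diag_coeff c c' * diag_coeff c' c) * w X"
        unfolding diag_coeff[OF bar nz] bal by (simp add: algebra_simps)
      ultimately show ?thesis
        using 1 True coeff_norm[OF ne] off_coeff[OF bar nz] by simp
    next
      case 2
      have "sigma_coeff lam i sX X = off_coeff c' c" "sigma_coeff lam i sX sX = diag_coeff c' c"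
        unfolding sigma_coeff_def csX inv(1) using \<open>sX \<noteq> X\<close> by auto
      \<comment> \<open>Orthogonality of the two rows of a block: \<open>a\<close> times the
        difference of the two sides of the balance equation.\<close>
      moreover have "diag_coeff c c' * (off_coeff c' c * w X) + off_coeff c c' * (- diag_coeff c c' * w sX) = 0"
        using bal by (simp add: algebra_simps)
      ultimately show ?thesis
        using 2 True \<open>sX \<noteq> X\<close> off_coeff[OF bar(2,1) nz(2,1)] diag_coeff[OF bar(2,1) nz(2,1)] by simp
    next
      case 3
      then have "sigma_coeff lam i Y X = 0" "sigma_coeff lam i Y sX = 0"
        using inv by (auto simp: sigma_coeff_def)
      then show ?thesis using 3 by (simp add: zero)
    qed
  qed
qed

text \<open>The rows of \<open>M\<close> are the images of the basis vectors; the hypothesis is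
  unitarity with respect to the weights. In the triple sum, summing over \<open>Z\<close> first
  leaves the original form.\<close>

lemma (in ratfun_hom) form_preserved:
  assumes "\<And>X Y. X \<in> standard_tableaux n lam \<Longrightarrow> Y \<in> standard_tableaux n lam \<Longrightarrow>
    (\<Sum>Z\<in>standard_tableaux n lam. M X Z * \<theta> (M Y Z) * form_weight n lam Z)
      = (if X = Y then form_weight n lam X else 0)"
  shows "form \<theta> n lam (\<lambda>Z. \<Sum>X\<in>standard_tableaux n lam. x X * M X Z)
    (\<lambda>Z. \<Sum>Y\<in>standard_tableaux n lam. y Y * M Y Z) = form \<theta> n lam x y"
proof -
  define S where "S = standard_tableaux n lam"
  define w where "w = form_weight n lam"
  have "form \<theta> n lam (\<lambda>Z. \<Sum>X\<in>S. x X * M X Z) (\<lambda>Z. \<Sum>Y\<in>S. y Y * M Y Z)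
      = (\<Sum>Z\<in>S. \<Sum>X\<in>S. \<Sum>Y\<in>S. x X * \<theta> (y Y) * (M X Z * \<theta> (M Y Z) * w Z))"
    unfolding form_def S_def[symmetric] w_def[symmetric] sum mult sum_product
    unfolding sum_distrib_right by (intro sum.cong refl) (simp only: mult_ac)
  also have "\<dots> = (\<Sum>X\<in>S. \<Sum>Y\<in>S. \<Sum>Z\<in>S. x X * \<theta> (y Y) * (M X Z * \<theta> (M Y Z) * w Z))"
    by (subst sum.swap) (intro sum.cong refl sum.swap)
  also have "\<dots> = (\<Sum>X\<in>S. \<Sum>Y\<in>S. x X * \<theta> (y Y) * (if X = Y then w X else 0))"
    using assms unfolding S_def w_def by (simp flip: sum_distrib_left)
  also have "\<dots> = form \<theta> n lam x y"
    unfolding form_def S_def[symmetric] w_def[symmetric]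
    by (intro sum.cong) (simp_all add: S_def finite_standard_tableaux if_distrib[of "(*) _"] cong: if_cong)
  finally show ?thesis by (simp only: S_def)
qed

text \<open>Matrix criterion for being self-adjoint with respect to the weighted form.\<close>

lemma (in ratfun_hom) form_adjoint:
  assumes "\<And>X Y. X \<in> standard_tableaux n lam \<Longrightarrow> Y \<in> standard_tableaux n lam \<Longrightarrow>
    M X Y * form_weight n lam Y = \<theta> (M Y X) * form_weight n lam X"
  shows "form \<theta> n lam (\<lambda>Z. \<Sum>X\<in>standard_tableaux n lam. x X * M X Z) y
    = form \<theta> n lam x (\<lambda>Z. \<Sum>Y\<in>standard_tableaux n lam. y Y * M Y Z)"
proof -
  define S where "S = standard_tableaux n lam"
  define w where "w = form_weight n lam"
  have "form \<theta> n lam (\<lambda>Z. \<Sum>X\<in>S. x X * M X Z) y = (\<Sum>Y\<in>S. \<Sum>X\<in>S. x X * \<theta> (y Y) * (M X Y * w Y))"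
    unfolding form_def S_def[symmetric] w_def[symmetric] sum_distrib_right
    by (intro sum.cong refl) (simp only: mult_ac)
  also have "\<dots> = (\<Sum>X\<in>S. \<Sum>Y\<in>S. x X * \<theta> (y Y) * (M X Y * w Y))"
    by (rule sum.swap)
  also have "\<dots> = (\<Sum>X\<in>S. \<Sum>Y\<in>S. x X * \<theta> (y Y) * (\<theta> (M Y X) * w X))"
    using assms unfolding S_def w_def by simp
  also have "\<dots> = form \<theta> n lam x (\<lambda>Z. \<Sum>Y\<in>S. y Y * M Y Z)"
    unfolding form_def S_def[symmetric] w_def[symmetric] sum mult
    unfolding sum_distrib_left sum_distrib_right by (intro sum.cong refl) (simp only: mult_ac)
  finally show ?thesis by (simp only: S_def)
qed

section \<open>The module action in the tableau basis\<close>

lemma hecke_actionD: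
  assumes "hecke_action m n lam act"
  shows hecke_action_closed:
      "\<lbrakk>h \<in> carrier (hecke m n); x \<in> Umod m n lam\<rbrakk> \<Longrightarrow> act h x \<in> Umod m n lam"
    and hecke_action_add: "\<lbrakk>h \<in> carrier (hecke m n); x \<in> Umod m n lam; y \<in> Umod m n lam\<rbrakk>
      \<Longrightarrow> act h (\<lambda>Y. x Y + y Y) = (\<lambda>Y. act h x Y + act h y Y)"
    and hecke_action_scale: "\<lbrakk>h \<in> carrier (hecke m n); r \<in> ground_ring m n; x \<in> Umod m n lam\<rbrakk>
      \<Longrightarrow> act h (\<lambda>Y. r * x Y) = (\<lambda>Y. r * act h x Y)"
    and hecke_action_mult: "\<lbrakk>g \<in> carrier (hecke m n); h \<in> carrier (hecke m n); x \<in> Umod m n lam\<rbrakk>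
      \<Longrightarrow> act (g \<otimes>\<^bsub>hecke m n\<^esub> h) x = act g (act h x)"
    and hecke_action_one: "x \<in> Umod m n lam \<Longrightarrow> act \<one>\<^bsub>hecke m n\<^esub> x = x"
    and hecke_action_tau: "X \<in> standard_tableaux n lam
      \<Longrightarrow> act (hgen m n Tau) (bvec n lam X) = (\<lambda>Y. tab_content lam X 1 * bvec n lam X Y)"
    and hecke_action_sigma: "\<lbrakk>X \<in> standard_tableaux n lam; i \<in> {1..<n}\<rbrakk>
      \<Longrightarrow> act (hgen m n (Sigma i)) (bvec n lam X) =
        (\<lambda>Y. diag_coeff (tab_content lam X i) (tab_content lam X (i + 1)) * bvec n lam X Y
           + off_coeff (tab_content lam X i) (tab_content lam X (i + 1))
             * bvec n lam (swap_entries lam i X) Y)"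
proof -
  note act = assms[unfolded hecke_action_def Let_def, folded diag_coeff_def off_coeff_def]
  note act2 = act[THEN conjunct2]
  note act3 = act2[THEN conjunct2]
  note act4 = act3[THEN conjunct2]
  note act5 = act4[THEN conjunct2]
  note act7 = act5[THEN conjunct2, THEN conjunct2]
  show "\<lbrakk>h \<in> carrier (hecke m n); x \<in> Umod m n lam\<rbrakk> \<Longrightarrow> act h x \<in> Umod m n lam"
    by (rule act[THEN conjunct1, rule_format])
  show "\<lbrakk>h \<in> carrier (hecke m n); x \<in> Umod m n lam; y \<in> Umod m n lam\<rbrakk>
      \<Longrightarrow> act h (\<lambda>Y. x Y + y Y) = (\<lambda>Y. act h x Y + act h y Y)"
    by (rule act2[THEN conjunct1, rule_format])
  show "\<lbrakk>h \<in> carrier (hecke m n); r \<in> ground_ring m n; x \<in> Umod m n lam\<rbrakk>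
      \<Longrightarrow> act h (\<lambda>Y. r * x Y) = (\<lambda>Y. r * act h x Y)"
    by (rule act3[THEN conjunct1, rule_format])
  show "\<lbrakk>g \<in> carrier (hecke m n); h \<in> carrier (hecke m n); x \<in> Umod m n lam\<rbrakk>
      \<Longrightarrow> act (g \<otimes>\<^bsub>hecke m n\<^esub> h) x = act g (act h x)"
    by (rule act4[THEN conjunct1, rule_format, THEN conjunct2])
  show "x \<in> Umod m n lam \<Longrightarrow> act \<one>\<^bsub>hecke m n\<^esub> x = x"
    by (rule act5[THEN conjunct1, rule_format])
  show "X \<in> standard_tableaux n lam
      \<Longrightarrow> act (hgen m n Tau) (bvec n lam X) = (\<lambda>Y. tab_content lam X 1 * bvec n lam X Y)"
    by (rule act7[THEN conjunct1, rule_format])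
  show "\<lbrakk>X \<in> standard_tableaux n lam; i \<in> {1..<n}\<rbrakk>
      \<Longrightarrow> act (hgen m n (Sigma i)) (bvec n lam X) =
        (\<lambda>Y. diag_coeff (tab_content lam X i) (tab_content lam X (i + 1)) * bvec n lam X Y
           + off_coeff (tab_content lam X i) (tab_content lam X (i + 1))
             * bvec n lam (swap_entries lam i X) Y)"
    by (rule act7[THEN conjunct2, rule_format])
qed

lemma bvec_Umod: "bvec n lam X \<in> Umod m n lam"
  by (auto simp: bvec_def Umod_def ground_ring_0 ground_ring_1)

lemma Umod_add: "x \<in> Umod m n lam \<Longrightarrow> y \<in> Umod m n lam \<Longrightarrow> (\<lambda>Y. x Y + y Y) \<in> Umod m n lam"
  by (simp add: Umod_def ground_ring_add)

lemma Umod_scale: "r \<in> ground_ring m n \<Longrightarrow> x \<in> Umod m n lam \<Longrightarrow> (\<lambda>Y. r * x Y) \<in> Umod m n lam"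
  by (simp add: Umod_def ground_ring_mult)

lemma hecke_action_expand:
  assumes act: "hecke_action m n lam act" and h: "h \<in> carrier (hecke m n)" and x: "x \<in> Umod m n lam"
  shows "act h x = (\<lambda>Z. \<Sum>X\<in>standard_tableaux n lam. x X * act h (bvec n lam X) Z)"
proof -
  \<comment> \<open>Additivity concerns two members of the module, so the induction also carries
    membership of the partial sums.\<close>
  have *: "(\<lambda>Z. \<Sum>X\<in>S. x X * bvec n lam X Z) \<in> Umod m n lam \<and>
      act h (\<lambda>Z. \<Sum>X\<in>S. x X * bvec n lam X Z) = (\<lambda>Z. \<Sum>X\<in>S. x X * act h (bvec n lam X) Z)"
    if "S \<subseteq> standard_tableaux n lam" for S
    using finite_subset[OF that finite_standard_tableaux] that
  proof (induction S rule: finite_induct)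
    case empty
    \<comment> \<open>The zero vector is \<open>0\<close> times \<open>x\<close>, so homogeneity
      settles the empty sum.\<close>
    show ?case
      using hecke_action_scale[OF act h ground_ring_0 x] by (simp add: Umod_def ground_ring_0)
  next
    case (insert X S)
    have xX: "x X \<in> ground_ring m n" using x insert.prems by (simp add: Umod_def)
    note U = Umod_scale[OF xX bvec_Umod]
    show ?case
      using insert Umod_add[OF U] hecke_action_add[OF act h U] hecke_action_scale[OF act h xX bvec_Umod]
      by simp
  qed
  have "x = (\<lambda>Z. \<Sum>X\<in>standard_tableaux n lam. x X * bvec n lam X Z)"
  proof
    fix Z
    have "(\<Sum>X\<in>standard_tableaux n lam. x X * bvec n lam X Z)
        = (\<Sum>X\<in>standard_tableaux n lam. if Z = X then x X else 0)"
      by (intro sum.cong) (auto simp: bvec_def)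
    also have "\<dots> = x Z"
      using x by (simp add: finite_standard_tableaux Umod_def)
    finally show "x Z = (\<Sum>X\<in>standard_tableaux n lam. x X * bvec n lam X Z)" ..
  qed
  then show ?thesis using *[OF subset_refl] by simp
qed

lemma hecke_action_sigma_coeff:
  assumes "hecke_action m n lam act" "X \<in> standard_tableaux n lam" "Z \<in> standard_tableaux n lam"
    "i \<in> {1..<n}"
  shows "act (hgen m n (Sigma i)) (bvec n lam X) Z = sigma_coeff lam i X Z"
  unfolding hecke_action_sigma[OF assms(1,2,4)]
  using assms(2,3) by (auto simp: sigma_coeff_def bvec_def)

lemma (in bar_hom) form_hgen_invariant:
  assumes lam: "is_multipartition m n lam" and act: "hecke_action m n lam act"
    and a: "a \<in> gens n" and x: "x \<in> Umod m n lam" and y: "y \<in> Umod m n lam"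
  shows "form \<theta> n lam (act (hgen m n a) x) (act (hgen m n a) y) = form \<theta> n lam x y"
  unfolding hecke_action_expand[OF act hgen_closed[OF a] x] hecke_action_expand[OF act hgen_closed[OF a] y]
proof (rule form_preserved)
  fix X Y assume X: "X \<in> standard_tableaux n lam" and Y: "Y \<in> standard_tableaux n lam"
  show "(\<Sum>Z\<in>standard_tableaux n lam. act (hgen m n a) (bvec n lam X) Z
      * \<theta> (act (hgen m n a) (bvec n lam Y) Z) * form_weight n lam Z)
    = (if X = Y then form_weight n lam X else 0)"
  proof (cases a)
    case Tau
    \<comment> \<open>The generator acts diagonally by nonzero contents, and \<theta> inverts each
      of them.\<close>
    have "(\<Sum>Z\<in>standard_tableaux n lam. act (hgen m n a) (bvec n lam X) Z
        * \<theta> (act (hgen m n a) (bvec n lam Y) Z) * form_weight n lam Z)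
      = (\<Sum>Z\<in>standard_tableaux n lam. if Z = X then (if X = Y then form_weight n lam X else 0) else 0)"
      using X Y unfolding Tau hecke_action_tau[OF act X] hecke_action_tau[OF act Y]
      by (intro sum.cong)
        (auto simp: bvec_def mult content zero one tab_content_nonzero)
    then show ?thesis using X by (simp add: finite_standard_tableaux)
  next
    case (Sigma i)
    then have i: "i \<in> {1..<n}" using a by (auto simp: gens_def)
    have "act (hgen m n a) (bvec n lam X) Z = sigma_coeff lam i X Z"
      if "X \<in> standard_tableaux n lam" "Z \<in> standard_tableaux n lam" for X Z
      unfolding Sigma by (rule hecke_action_sigma_coeff[OF act that i])
    then show ?thesis
      using sigma_coeff_unitary[OF lam i X Y] X Y by (simp cong: sum.cong)
  qed
qed

lemma gamma_form_hgen_adjoint: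
  assumes lam: "is_multipartition m n lam" and act: "hecke_action m n lam act"
    and a: "a \<in> gens n" and x: "x \<in> Umod m n lam" and y: "y \<in> Umod m n lam"
  shows "form gamma_invol n lam (act (hgen m n a) x) y = form gamma_invol n lam x (act (hgen m n a) y)"
  unfolding hecke_action_expand[OF act hgen_closed[OF a] x] hecke_action_expand[OF act hgen_closed[OF a] y]
proof (rule gamma.form_adjoint)
  fix X Y assume X: "X \<in> standard_tableaux n lam" and Y: "Y \<in> standard_tableaux n lam"
  show "act (hgen m n a) (bvec n lam X) Y * form_weight n lam Y
    = gamma_invol (act (hgen m n a) (bvec n lam Y) X) * form_weight n lam X"
  proof (cases a)
    case Tau
    show ?thesis
      unfolding Tau hecke_action_tau[OF act X] hecke_action_tau[OF act Y]
      by (auto simp: bvec_def gamma_mult gamma_content)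
  next
    case (Sigma i)
    then have i: "i \<in> {1..<n}" using a by (auto simp: gens_def)
    \<comment> \<open>The entries are rational expressions in \<open>q\<close> and the parameters
      with integer coefficients.\<close>
    have "gamma_invol (sigma_coeff lam i Y X) = sigma_coeff lam i Y X"
      by (simp add: sigma_coeff_def diag_coeff_def off_coeff_def gamma_add gamma_mult gamma_diff
          gamma.divide gamma_inverse gamma_values gamma_content)
    then show ?thesis
      using sigma_coeff_symmetric[OF lam i X Y]
      unfolding Sigma hecke_action_sigma_coeff[OF act X Y i] hecke_action_sigma_coeff[OF act Y X i]
      by simp
  qed
qed

theorem mainTheorem8:
  fixes m n :: nat and lam :: "nat list list"
    and act :: "(word \<Rightarrow>\<^sub>0 ratfun) set \<Rightarrow> vect \<Rightarrow> vect"
  assumes "m \<ge> 1" and "n \<ge> 1"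
    and "is_multipartition m n lam"
    and "hecke_action m n lam act"
  shows "\<forall>x\<in>Umod m n lam. \<forall>y\<in>Umod m n lam. \<forall>a\<in>gens n.
      form gamma_invol n lam (act (hgen m n a) x) (act (inv\<^bsub>hecke m n\<^esub> (hgen m n a)) y)
        = form gamma_invol n lam x y \<and>
      form omega_invol n lam (act (hgen m n a) x) (act (hgen m n a) y)
        = form omega_invol n lam x y \<and>
      form varpi_invol n lam (act (hgen m n a) x) (act (hgen m n a) y)
        = form varpi_invol n lam x y"
proof (intro ballI conjI)
  fix x y a assume x: "x \<in> Umod m n lam" and y: "y \<in> Umod m n lam" and a: "a \<in> gens n"
  interpret H: ring "hecke m n" by (rule ring_hecke)
  let ?g = "hgen m n a" and ?g' = "inv\<^bsub>hecke m n\<^esub> (hgen m n a)"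
  have g: "?g \<in> carrier (hecke m n)" "?g' \<in> carrier (hecke m n)"
    using hgen_unit[OF a] by auto
  \<comment> \<open>For \<gamma>, self-adjointness moves the generator to the second argument, where
    it cancels its inverse.\<close>
  have "act ?g (act ?g' y) = y"
    using hecke_action_mult[OF assms(4) g y] H.Units_r_inv[OF hgen_unit[OF a]]
      hecke_action_one[OF assms(4) y] by simp
  then show "form gamma_invol n lam (act ?g x) (act ?g' y) = form gamma_invol n lam x y"
    using gamma_form_hgen_adjoint[OF assms(3,4) a x hecke_action_closed[OF assms(4) g(2) y]] by simp
  show "form omega_invol n lam (act ?g x) (act ?g y) = form omega_invol n lam x y"
    by (rule omega.form_hgen_invariant[OF assms(3,4) a x y])
  show "form varpi_invol n lam (act ?g x) (act ?g y) = form varpi_invol n lam x y"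
    by (rule varpi.form_hgen_invariant[OF assms(3,4) a x y])
qed

end
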